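(* Let $A_i:\mathcal H\rightrightarrows\mathcal H$ be maximal $\sigma_i$-comonotone for $i=1,\dots,m$, and suppose $\operatorname{zer}(A_1+\cdots+A_m)\neq\emptyset$. Denote $\underline{\sigma}:=\min_{1\le i\le m-1}\sigma_i$. Let $(\gamma,\delta,\lambda,\mu)\in\mathbb R_{++}^4$ satisfy $$(\lambda-1)(\mu-1)=1\quad\text{and}\quad \delta=\gamma(\lambda-1),$$ and suppose that one of the following conditions holds: (C1) $\underline\sigma=-(m-1)\sigma_m\ge 0$ and $\delta=\gamma+2\underline\sigma$; (C2) $\underline\sigma>-(m-1)\sigma_m\ge 0$ and $(\gamma+\delta)^2<4(\gamma+\underline\sigma)(\delta+(m-1)\sigma_m)$; (C3) $\sigma_i>0$ for $i=1,\dots,m-1$, $\sigma_m<0$ and $\sum_{i=1}^m\frac1{\sigma_i}<0$; in addition, $\kappa\in(0,1)$ and, for some $\theta=(\theta_1,\dots,\theta_{m-1})\in\Theta$, with $$\kappa_i^*:=\frac{4(\gamma+\sigma_i)(\delta+\sigma_m\theta_i)-(\gamma+\delta)^2}{2(\gamma+\delta)(\sigma_i+\sigma_m\theta_i)}\quad(i=1,\dots,m-1),$$ either (a) $\min_{1\le i\le m-1}\kappa_i^*\ge 1$; or (b) $\gamma=\delta>0$, $\lambda=\mu=2$, and $\min_{1\le i\le m-1}\kappa_i^*>\kappa$. Here $\Theta:=\{\theta\in\mathbb R^{m-1}:\ \theta_i>0 \text{ and } \sigma_i+\sigma_m\theta_i>0 \text{ for all } i=1,\dots,m-1,\ \text{and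 } \sum_{i=1}^{m-1}\frac1{\theta_i}=1\}$. Assume $\kappa^*>0$, where $$\kappa^*:=\begin{cases}1 & \text{if (C1) or (C3) holds},\\ \dfrac{4(\gamma+\underline\sigma)(\delta+(m-1)\sigma_m)-(\gamma+\delta)^2}{2(\gamma+\delta)(\underline\sigma+(m-1)\sigma_m)} & \text{if (C2) holds},\end{cases}$$ and let $\kappa\in(0,\kappa^* )$. Let $\{(\mathbf x^k,\mathbf y^k,\mathbf z^k)\}$ be generated, from an arbitrary initial point $\mathbf x^0\in\mathcal H^{m-1}$, by $$\mathbf y^k\in J_{\gamma\mathbf F}(\mathbf x^k),\qquad \mathbf z^k\in J_{\delta\mathbf G}((1-\lambda)\mathbf x^k+\lambda\mathbf y^k),\qquad \mathbf x^{k+1}=\mathbf x^k+\kappa\mu(\mathbf z^k-\mathbf y^k).$$ Then: (i) There exists $\bar{\mathbf x}\in\operatorname{Fix}(T_{\mathbf F,\mathbf G})$ with $J_{\gamma\mathbf F}(\bar{\mathbf x})\in\operatorname{zer}(\mathbf F+\mathbf G)$ such that $\mathbf x^k\rightharpoonup\bar{\mathbf x}$. (ii) $\|\mathbf x^k-\mathbf x^{k+1}\|=o(1/\sqrt k)$ and $\|\mathbf y^k-\mathbf y^{k+1}\|=o(1/\sqrt k)$ as $k\to\infty$. (iii) The sequences $\{\mathbf y^k\}$ and $\{\mathbf z^k\}$ converge weakly to $J_{\gamma\mathbf F}(\bar{\mathbf x})\in\operatorname{zer}(\mathbf F+\mathbf G)$. (iv) If (C2) holds with $\sigma_m=0$ or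 if (C3) holds, then $\{\mathbf x^k-\mathbf y^k\}$ and $\{\mathbf x^k-\mathbf z^k\}$ converge strongly to $\gamma\,{}^{\gamma}\mathbf F(\bar{\mathbf x})=\bar{\mathbf x}-J_{\gamma\mathbf F}(\bar{\mathbf x})$, and $\gamma\,{}^{\gamma}\mathbf F(\bar{\mathbf x})+\operatorname{zer}(\mathbf F+\mathbf G)=\operatorname{Fix}(T_{\mathbf F,\mathbf G})$.
   Context: $\mathcal H$ is a real Hilbert space, $m\ge2$, and $\mathcal H^{m-1}$ carries the product Hilbert structure; $\to$ and $\rightharpoonup$ denote strong and weak convergence. A set-valued operator $A:\mathcal H\rightrightarrows\mathcal H$ maps points to (possibly empty) subsets; $\operatorname{gra}(A)=\{(x,u):u\in A(x)\}$, $\operatorname{zer}(A)=\{x:0\in A(x)\}$, $\operatorname{Fix}(A)=\{x:x\in A(x)\}$. For $\sigma\in\mathbb R$, $A$ is $\sigma$-comonotone if $\langle x-y,u-v\rangle\ge\sigma\|u-v\|^2$ for all $(x,u),(y,v)\in\operatorname{gra}(A)$, and maximal $\sigma$-comonotone if moreover no $\sigma$-comonotone operator has a graph properly containing $\operatorname{gra}(A)$. The resolvent is $J_{\gamma A}=(\mathrm{Id}+\gamma A)^{-1}$, the $\lambda$-relaxed resolvent is $J_{\gamma A}^{\lambda}=\lambda J_{\gamma A}+(1-\lambda)\mathrm{Id}$, and the Yosida approximation is ${}^{\gamma}A=\frac1\gamma(\mathrm{Id}-J_{\gamma A})$. Let $\mathbf D_{m-1}=\{(x_1,\dots,x_{m-1})\in\mathcal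 H^{m-1}:x_1=\cdots=x_{m-1}\}$, with normal cone operator $N_{\mathbf D_{m-1}}(\mathbf x)=\mathbf D_{m-1}^\perp=\{\mathbf w:\sum_{i=1}^{m-1}w_i=0\}$ if $\mathbf x\in\mathbf D_{m-1}$ and $\emptyset$ otherwise. For $\mathbf x=(x_1,\dots,x_{m-1})$ define $$\mathbf F(\mathbf x)=A_1(x_1)\times\cdots\times A_{m-1}(x_{m-1}),\qquad \mathbf G(\mathbf x)=\mathbf K(\mathbf x)+N_{\mathbf D_{m-1}}(\mathbf x),$$ where $\mathbf K(\mathbf x)=\{\frac1{m-1}(v,\dots,v):v\in A_m(x_1)\}$ if $\mathbf x\in\mathbf D_{m-1}$ and $\mathbf K(\mathbf x)=\emptyset$ otherwise. The adaptive Douglas–Rachford operator is $T_{\mathbf F,\mathbf G}=(1-\kappa)\mathrm{Id}+\kappa J_{\delta\mathbf G}^{\mu}J_{\gamma\mathbf F}^{\lambda}$. *)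

theory Defs
  imports "HOL-Analysis.Analysis" "HOL-Library.Landau_Symbols"
begin

text \<open>
  Sums of sets are Minkowski sums (\<^theory>\<open>HOL-Library.Set_Algebras\<close>).  The product space
  \<open>H ^ (m - 1)\<close> is the type \<open>'a ^ 'n\<close> with \<open>CARD('n) = m - 1\<close>; since a finite type is
  nonempty, \<open>m \<ge> 2\<close> holds automatically.  The indices \<open>1, ..., m - 1\<close> are the elements of \<open>'n\<close>;
  the data with index \<open>m\<close> are kept as separate arguments (\<open>Am\<close>, \<open>\<sigma>m\<close>).
\<close>

type_synonym 'a operator = "'a \<Rightarrow> 'a set"


subsection \<open>Set-valued operators\<close>

definition gra :: "'a operator \<Rightarrow> ('a \<times> 'a) set" where
  "gra A = {(x, u). u \<in> A x}"

definition zer :: "'a::zero operator \<Rightarrow> 'a set" where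
  "zer A = {x. 0 \<in> A x}"

definition Fix :: "'a operator \<Rightarrow> 'a set" where
  "Fix A = {x. x \<in> A x}"

definition comonotone :: "real \<Rightarrow> 'a::real_inner operator \<Rightarrow> bool" where
  "comonotone \<sigma> A \<longleftrightarrow>
    (\<forall>(x, u) \<in> gra A. \<forall>(y, v) \<in> gra A. inner (x - y) (u - v) \<ge> \<sigma> * (norm (u - v))\<^sup>2)"

definition maximal_comonotone :: "real \<Rightarrow> 'a::real_inner operator \<Rightarrow> bool" where
  "maximal_comonotone \<sigma> A \<longleftrightarrow>
    comonotone \<sigma> A \<and> \<not> (\<exists>B. comonotone \<sigma> B \<and> gra A \<subset> gra B)"

text \<open>\<open>y \<in> (Id + \<gamma> A)\<^sup>-\<^sup>1 x\<close> iff \<open>x \<in> y + \<gamma> A y\<close>; no single-valuedness is built in.\<close>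

definition resolvent :: "real \<Rightarrow> 'a::real_vector operator \<Rightarrow> 'a operator" where
  "resolvent \<gamma> A x = {y. \<exists>u \<in> A y. x = y + \<gamma> *\<^sub>R u}"

definition relaxed_resolvent :: "real \<Rightarrow> real \<Rightarrow> 'a::real_vector operator \<Rightarrow> 'a operator" where
  "relaxed_resolvent lam \<gamma> A x = (\<lambda>y. lam *\<^sub>R y + (1 - lam) *\<^sub>R x) ` resolvent \<gamma> A x"

definition yosida :: "real \<Rightarrow> 'a::real_vector operator \<Rightarrow> 'a operator" where
  "yosida \<gamma> A x = (\<lambda>y. (1 / \<gamma>) *\<^sub>R (x - y)) ` resolvent \<gamma> A x"

definition adaptive_DR ::
    "real \<Rightarrow> real \<Rightarrow> real \<Rightarrow> real \<Rightarrow> real \<Rightarrow>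
      'a::real_vector operator \<Rightarrow> 'a operator \<Rightarrow> 'a operator" where
  "adaptive_DR \<kappa> \<gamma> \<delta> lam \<mu> F G x =
    (\<lambda>w. (1 - \<kappa>) *\<^sub>R x + \<kappa> *\<^sub>R w) `
      (\<Union>v \<in> relaxed_resolvent lam \<gamma> F x. relaxed_resolvent \<mu> \<delta> G v)"

definition weakly_tendsto :: "(nat \<Rightarrow> 'a::real_inner) \<Rightarrow> 'a \<Rightarrow> bool" where
  "weakly_tendsto x l \<longleftrightarrow> (\<forall>v. (\<lambda>k. inner (x k) v) \<longlonglongrightarrow> inner l v)"

definition normal_cone :: "'a::real_inner set \<Rightarrow> 'a operator" where
  "normal_cone C x = (if x \<in> C then {w. \<forall>c \<in> C. inner w (c - x) \<le> 0} else {})"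


subsection \<open>The product space reformulation\<close>

definition diagonal :: "('a ^ 'n) set" where
  "diagonal = {x. \<forall>i j. x $ i = x $ j}"

lemma normal_cone_diagonal:
  fixes x :: "'a::real_inner ^ 'n"
  shows "normal_cone diagonal x = (if x \<in> diagonal then {w. (\<Sum>i\<in>UNIV. w $ i) = 0} else {})"
proof (cases "x \<in> diagonal")
  case True
  then obtain a where x: "\<And>i. x $ i = a"
    unfolding diagonal_def by blast
  have "(\<forall>c\<in>diagonal. inner w (c - x) \<le> 0) \<longleftrightarrow> (\<Sum>i\<in>UNIV. w $ i) = 0" for w :: "'a ^ 'n"
  proof
    let ?s = "\<Sum>i\<in>UNIV. w $ i"
    assume *: "\<forall>c\<in>diagonal. inner w (c - x) \<le> 0"
    have "(\<chi> i. a + ?s) \<in> (diagonal :: ('a ^ 'n) set)"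
      by (simp add: diagonal_def)
    from *[rule_format, OF this] have "inner ?s ?s \<le> 0"
      by (simp add: inner_vec_def x flip: inner_sum_left)
    then show "?s = 0"
      by (metis inner_eq_zero_iff inner_ge_zero order_antisym)
  next
    assume *: "(\<Sum>i\<in>UNIV. w $ i) = 0"
    show "\<forall>c\<in>diagonal. inner w (c - x) \<le> 0"
    proof
      fix c :: "'a ^ 'n" assume "c \<in> diagonal"
      then obtain b where c: "\<And>i. c $ i = b"
        unfolding diagonal_def by blast
      show "inner w (c - x) \<le> 0"
        using * by (simp add: inner_vec_def x c flip: inner_sum_left)
    qed
  qed
  with True show ?thesis by (simp add: normal_cone_def)
qed (simp add: normal_cone_def)

definition product_op :: "('n \<Rightarrow> 'a operator) \<Rightarrow> ('a ^ 'n) operator" where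
  "product_op A x = {u. \<forall>i. u $ i \<in> A i (x $ i)}"

text \<open>On the diagonal all components of \<open>x\<close> agree, so it does not matter at which \<open>i\<close> the
  operator \<open>Am\<close> is evaluated.\<close>

definition diagonal_op :: "'a::real_vector operator \<Rightarrow> ('a ^ 'n) operator" where
  "diagonal_op Am x =
    (if x \<in> diagonal
     then {(\<chi> i. (1 / real CARD('n)) *\<^sub>R v) | v. \<exists>i. v \<in> Am (x $ i)} else {})"

definition G_op :: "'a::real_inner operator \<Rightarrow> ('a ^ 'n) operator" where
  "G_op Am x = diagonal_op Am x + normal_cone diagonal x"


subsection \<open>Conditions on the parameters\<close>

definition cond_C1 :: "('n::finite \<Rightarrow> real) \<Rightarrow> real \<Rightarrow> real \<Rightarrow> real \<Rightarrow> bool" where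
  "cond_C1 \<sigma> \<sigma>m \<gamma> \<delta> \<longleftrightarrow>
    Min (range \<sigma>) = - (real CARD('n) * \<sigma>m) \<and> - (real CARD('n) * \<sigma>m) \<ge> 0 \<and>
    \<delta> = \<gamma> + 2 * Min (range \<sigma>)"

definition cond_C2 :: "('n::finite \<Rightarrow> real) \<Rightarrow> real \<Rightarrow> real \<Rightarrow> real \<Rightarrow> bool" where
  "cond_C2 \<sigma> \<sigma>m \<gamma> \<delta> \<longleftrightarrow>
    Min (range \<sigma>) > - (real CARD('n) * \<sigma>m) \<and> - (real CARD('n) * \<sigma>m) \<ge> 0 \<and>
    (\<gamma> + \<delta>)\<^sup>2 < 4 * (\<gamma> + Min (range \<sigma>)) * (\<delta> + real CARD('n) * \<sigma>m)"

definition Theta :: "('n::finite \<Rightarrow> real) \<Rightarrow> real \<Rightarrow> ('n \<Rightarrow> real) set" where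
  "Theta \<sigma> \<sigma>m =
    {\<theta>. (\<forall>i. \<theta> i > 0 \<and> \<sigma> i + \<sigma>m * \<theta> i > 0) \<and> (\<Sum>i\<in>UNIV. 1 / \<theta> i) = 1}"

text \<open>\<open>kappa_bound s t \<gamma> \<delta>\<close> is the threshold for comonotonicity moduli \<open>s\<close> and \<open>t\<close>; it yields
  \<open>\<kappa>\<^sub>i\<^sup>*\<close> for \<open>s = \<sigma> i\<close>, \<open>t = \<sigma>m * \<theta> i\<close>, and the value of \<open>\<kappa>\<^sup>*\<close> under condition C2 for
  \<open>s = Min (range \<sigma>)\<close>, \<open>t = (m - 1) * \<sigma>m\<close>.\<close>

definition kappa_bound :: "real \<Rightarrow> real \<Rightarrow> real \<Rightarrow> real \<Rightarrow> real" where
  "kappa_bound s t \<gamma> \<delta> =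
    (4 * (\<gamma> + s) * (\<delta> + t) - (\<gamma> + \<delta>)\<^sup>2) / (2 * (\<gamma> + \<delta>) * (s + t))"

definition cond_C3 ::
    "('n::finite \<Rightarrow> real) \<Rightarrow> real \<Rightarrow> real \<Rightarrow> real \<Rightarrow> real \<Rightarrow> real \<Rightarrow> real \<Rightarrow> bool" where
  "cond_C3 \<sigma> \<sigma>m \<gamma> \<delta> lam \<mu> \<kappa> \<longleftrightarrow>
    (\<forall>i. \<sigma> i > 0) \<and> \<sigma>m < 0 \<and> (\<Sum>i\<in>UNIV. 1 / \<sigma> i) + 1 / \<sigma>m < 0 \<and>
    0 < \<kappa> \<and> \<kappa> < 1 \<and>
    (\<exists>\<theta> \<in> Theta \<sigma> \<sigma>m.
      Min (range (\<lambda>i. kappa_bound (\<sigma> i) (\<sigma>m * \<theta> i) \<gamma> \<delta>)) \<ge> 1 \<or>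
      (\<gamma> = \<delta> \<and> \<delta> > 0 \<and> lam = 2 \<and> \<mu> = 2 \<and>
       Min (range (\<lambda>i. kappa_bound (\<sigma> i) (\<sigma>m * \<theta> i) \<gamma> \<delta>)) > \<kappa>))"

text \<open>C2 and C3 may hold simultaneously.  As C3 includes \<open>\<kappa> < 1\<close>, giving C3 precedence in the
  definition of \<open>\<kappa>\<^sup>*\<close> does not exclude any admissible \<open>\<kappa>\<close>.\<close>

definition kappa_star ::
    "('n::finite \<Rightarrow> real) \<Rightarrow> real \<Rightarrow> real \<Rightarrow> real \<Rightarrow> real \<Rightarrow> real \<Rightarrow> real \<Rightarrow> real" where
  "kappa_star \<sigma> \<sigma>m \<gamma> \<delta> lam \<mu> \<kappa> =
    (if cond_C1 \<sigma> \<sigma>m \<gamma> \<delta> \<or> cond_C3 \<sigma> \<sigma>m \<gamma> \<delta> lam \<mu> \<kappa> then 1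
     else kappa_bound (Min (range \<sigma>)) (real CARD('n) * \<sigma>m) \<gamma> \<delta>)"

end

(*  With a = (x - y) / gamma in F(y) and b in G(z), one step of the algorithm is
    x+ = x - kappa (gamma + delta) (a + b), and the fixed points of T are the points
    y + gamma a with a in F(y) and -a in G(y).  Comonotonicity of F and G, together with the
    weighted Cauchy-Schwarz inequality |sum b_i|^2 <= sum theta_i |b_i|^2 for sigma_m <= 0,
    reduces everything to a quadratic inequality in each component, which the parameter
    conditions make true with a margin eps |a + b|^2 + eta |a|^2.  Hence the step contracts
    distances up to this margin, the iterates are Fejer monotone, and |a_k + b_k|^2 is summable
    and decreasing, which gives the rates.  Weak cluster points are fixed points by a direct
    limit argument in the graphs; this needs only maximality, not that the resolvents have
    full domain.  Opial's lemma then gives weak convergence of x_k.  If eta > 0, then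
    |a_k - a|^2 is summable for every dual solution a, so a is unique and a_k converges to it
    strongly.  *)
theory Submission
  imports Defs "HOL-Library.Diagonal_Subsequence"
begin

text \<open>The obstacle is the modulus \<open>\<sigma>m\<close>, which may be negative: G need not
  be monotone, so neither resolvent estimates for monotone operators nor the closedness of monotone
  graphs can be quoted for it. The moduli of F compensate, hence the inequalities of F and G must be
  added before anything is estimated. They do not match directly: F has one modulus per component,
  while G sees only the sum of the components of b. The weights \<open>\<theta>\<close> distribute
  \<sigma>m |sum b_i|^2 over the components.

  The constants come from the step length \<tau> = \<kappa> (\<gamma> + \<delta>). Expanding the
  squared distance after a step produces \<tau>^2 |a + b|^2, and absorbing it costs (\<tau> / 2) |a
  + b|^2 in the quadratic inequality. So \<kappa> must stay below the best coefficient of |a + b|^2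
  divided by (\<gamma> + \<delta>) / 2; completing the square identifies this quotient as
  \<open>kappa_bound\<close>. Its denominator vanishes in the balanced case s + t = 0. This is C1,
  where the form is an exact multiple of |a + b|^2, gives no control of a alone, and forces
  \<open>\<eta>\<close> = 0.\<close>

section \<open>Weak convergence in Hilbert spaces\<close>

text \<open>The representing vector minimises \<open>\<parallel>x\<parallel>\<^sup>2 - 2 L x\<close> over the subspace.\<close>

lemma Riesz_closed_subspace:
  fixes S :: "'a::{real_inner, complete_space} set" and L :: "'a \<Rightarrow> real"
  assumes S: "subspace S" "closed S"
    and add: "\<And>x y. x \<in> S \<Longrightarrow> y \<in> S \<Longrightarrow> L (x + y) = L x + L y"
    and scale: "\<And>c x. x \<in> S \<Longrightarrow> L (c *\<^sub>R x) = c * L x"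
    and bounded: "\<And>x. x \<in> S \<Longrightarrow> \<bar>L x\<bar> \<le> M * norm x"
  obtains s where "s \<in> S" "\<And>x. x \<in> S \<Longrightarrow> L x = inner s x"
proof -
  define J where "J x = (norm x)\<^sup>2 - 2 * L x" for x
  define m where "m = Inf (J ` S)"
  have "0 \<in> S" using S by (simp add: subspace_0)
  \<comment> \<open>\<open>J x\<close> is at least |x|^2 - 2 M |x|, which is (|x| - M)^2 -
    M^2.\<close>
  have J_ge: "- M\<^sup>2 \<le> J x" if "x \<in> S" for x
  proof -
    have "0 \<le> (norm x - M)\<^sup>2" by simp
    then show ?thesis
      using bounded[OF that] by (simp add: J_def power2_diff abs_le_iff algebra_simps)
  qed
  have bdd: "bdd_below (J ` S)"
    by (rule bdd_belowI2[OF J_ge])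
  have m_le: "m \<le> J x" if "x \<in> S" for x
    unfolding m_def using that bdd by (intro cInf_lower) auto
  have "\<exists>x\<in>S. J x < m + 1 / real (Suc k)" for k
  proof -
    have "Inf (J ` S) < m + 1 / real (Suc k)" by (simp add: m_def)
    then show ?thesis
      using cInf_lessD[of "J ` S"] \<open>0 \<in> S\<close> by auto
  qed
  then obtain s where s: "\<And>k. s k \<in> S" "\<And>k. J (s k) < m + 1 / real (Suc k)"
    by metis
  \<comment> \<open>The parallelogram law at the midpoint, where \<open>J\<close> is still at least
    \<open>m\<close>: near-minimisers are close to each other, so a minimising sequence is
    Cauchy.\<close>
  have par: "(norm (x - y))\<^sup>2 \<le> 2 * (J x - m) + 2 * (J y - m)" if "x \<in> S" "y \<in> S" for x y
  proof -
    have mem: "(1/2) *\<^sub>R (x + y) \<in> S"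
      using that S by (intro subspace_scale subspace_add)
    have "J ((1/2) *\<^sub>R (x + y)) = (norm (x + y))\<^sup>2 / 4 - (L x + L y)"
      using that S add scale[of "x + y" "1/2"]
      by (simp add: J_def subspace_add power_divide)
    moreover have "(norm (x - y))\<^sup>2 + (norm (x + y))\<^sup>2 = 2 * (norm x)\<^sup>2 + 2 * (norm y)\<^sup>2"
      by (simp add: power2_norm_eq_inner algebra_simps)
    ultimately show ?thesis
      using m_le[OF mem] by (simp add: J_def)
  qed
  have "Cauchy s"
  proof (rule metric_CauchyI)
    fix e :: real assume "e > 0"
    obtain N where N: "1 / real (Suc N) < e\<^sup>2 / 4"
      using reals_Archimedean[of "e\<^sup>2 / 4"] \<open>e > 0\<close> by (auto simp: inverse_eq_divide)
    have small: "J (s k) - m < e\<^sup>2 / 4" if "k \<ge> N" for k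
    proof -
      have "1 / real (Suc k) \<le> 1 / real (Suc N)"
        using that by (intro divide_left_mono) auto
      with s(2)[of k] N show ?thesis by linarith
    qed
    show "\<exists>N. \<forall>i\<ge>N. \<forall>k\<ge>N. dist (s i) (s k) < e"
    proof (intro exI allI impI)
      fix i k assume "N \<le> i" "N \<le> k"
      have "(norm (s i - s k))\<^sup>2 \<le> 2 * (J (s i) - m) + 2 * (J (s k) - m)"
        by (rule par[OF s(1) s(1)])
      also have "\<dots> < 2 * (e\<^sup>2 / 4) + 2 * (e\<^sup>2 / 4)"
        using small[OF \<open>N \<le> i\<close>] small[OF \<open>N \<le> k\<close>] by (intro add_strict_mono mult_strict_left_mono) auto
      finally have "(norm (s i - s k))\<^sup>2 < e\<^sup>2" by simp
      then show "dist (s i) (s k) < e"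
        using \<open>e > 0\<close> by (simp add: dist_norm power_less_imp_less_base)
    qed
  qed
  then obtain l where l: "s \<longlonglongrightarrow> l"
    using Cauchy_convergent convergent_def by blast
  have "l \<in> S" using S(2) s(1) l closed_sequentially by blast
  have "(\<lambda>k. L (s k)) \<longlonglongrightarrow> L l"
  proof (rule Lim_null_comparison[THEN LIM_zero_cancel])
    show "\<forall>\<^sub>F k in sequentially. norm (L (s k) - L l) \<le> M * norm (s k - l)"
    proof (intro always_eventually allI)
      fix k
      have "L (s k) - L l = L (s k - l)"
        using add[of "s k - l" l] S s(1) \<open>l \<in> S\<close> by (simp add: subspace_diff)
      then show "norm (L (s k) - L l) \<le> M * norm (s k - l)"
        using bounded[of "s k - l"] S s(1) \<open>l \<in> S\<close> by (simp add: subspace_diff)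
    qed
    show "(\<lambda>k. M * norm (s k - l)) \<longlonglongrightarrow> 0"
      using tendsto_mult_right_zero[OF tendsto_norm_zero[OF LIM_zero[OF l]]] .
  qed
  then have "(\<lambda>k. J (s k)) \<longlonglongrightarrow> J l"
    unfolding J_def by (intro tendsto_intros l)
  moreover have "(\<lambda>k. m + 1 / real (Suc k)) \<longlonglongrightarrow> m + 0"
    using LIMSEQ_inverse_real_of_nat by (intro tendsto_add) (simp_all add: inverse_eq_divide)
  ultimately have "J l \<le> m"
    using s(2) by (intro LIMSEQ_le[of _ _ _ m]) (auto intro: less_imp_le)
  have "L w = inner l w" if "w \<in> S" for w
  proof -
    define d where "d = inner l w - L w"
    \<comment> \<open>Minimality of \<open>l\<close> along the line in direction \<open>w\<close>. A
      nonzero linear coefficient \<open>d\<close> would make this polynomial negative for small t of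
      the opposite sign.\<close>
    have *: "0 \<le> t\<^sup>2 * (norm w)\<^sup>2 + 2 * t * d" for t
    proof -
      have "l + t *\<^sub>R w \<in> S" using S that \<open>l \<in> S\<close> by (intro subspace_add subspace_scale)
      then have "J l \<le> J (l + t *\<^sub>R w)" using m_le \<open>J l \<le> m\<close> by force
      moreover have "(norm (l + t *\<^sub>R w))\<^sup>2 = (norm l)\<^sup>2 + 2 * t * inner l w + t\<^sup>2 * (norm w)\<^sup>2"
        unfolding power2_norm_eq_inner by (simp add: algebra_simps inner_commute power2_eq_square)
      then have "J (l + t *\<^sub>R w) = J l + t\<^sup>2 * (norm w)\<^sup>2 + 2 * t * d"
        using S that \<open>l \<in> S\<close>
        by (simp add: J_def d_def add scale subspace_scale algebra_simps)
      ultimately show ?thesis by simp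
    qed
    have "d = 0"
    proof (rule ccontr)
      assume "d \<noteq> 0"
      \<comment> \<open>The added 1 covers w = 0; the choice t = - d / N leaves the factor |w|^2 / N
        - 2 \<le> -1.\<close>
      define N where "N = (norm w)\<^sup>2 + 1"
      have "N > 0" by (simp add: N_def add_nonneg_pos)
      have "0 \<le> (d / N)\<^sup>2 * (norm w)\<^sup>2 + 2 * (- (d / N)) * d"
        using *[of "- (d / N)"] by simp
      also have "\<dots> = (d\<^sup>2 / N) * ((norm w)\<^sup>2 / N - 2)"
        using \<open>N > 0\<close> by (simp add: power_divide power2_eq_square field_simps)
      also have "\<dots> < 0"
      proof (rule mult_pos_neg)
        show "0 < d\<^sup>2 / N" using \<open>d \<noteq> 0\<close> \<open>N > 0\<close> by simp
        have "(norm w)\<^sup>2 / N \<le> 1" using \<open>N > 0\<close> by (simp add: N_def)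
        then show "(norm w)\<^sup>2 / N - 2 < 0" by simp
      qed
      finally show False by simp
    qed
    then show ?thesis by (simp add: d_def)
  qed
  with \<open>l \<in> S\<close> show ?thesis using that by blast
qed

text \<open>Separability is avoided by testing only against the sequence itself. A diagonal
  subsequence makes all inner products with the \<open>x n\<close> converge; the test vectors
  \<open>S\<close> for which this happens form a closed subspace, and the limit functional on
  \<open>S\<close> is represented by a vector. Other test vectors are projected onto
  \<open>S\<close>.\<close>

lemma bounded_imp_weakly_convergent_subseq:
  fixes x :: "nat \<Rightarrow> 'a::{real_inner, complete_space}"
  assumes "\<And>k. norm (x k) \<le> M"
  obtains r l where "strict_mono r" "weakly_tendsto (x \<circ> r) l"
proof -
  define P where "P n s = convergent (\<lambda>k. inner (x (s k)) (x n))" for n and s :: "nat \<Rightarrow> nat"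
  have inner_le: "\<bar>inner (x k) v\<bar> \<le> M * norm v" for k v
    using Cauchy_Schwarz_ineq2[of "x k" v] mult_right_mono[OF assms[of k] norm_ge_zero[of v]]
    by linarith
  interpret subseqs P
  proof
    fix n and s :: "nat \<Rightarrow> nat" assume "strict_mono s"
    have "bounded (range (\<lambda>k. inner (x (s k)) (x n)))"
      using inner_le by (auto simp: bounded_iff)
    then obtain l r where "strict_mono r" "((\<lambda>k. inner (x (s k)) (x n)) \<circ> r) \<longlonglongrightarrow> l"
      using bounded_imp_convergent_subsequence by blast
    then show "\<exists>r'. strict_mono r' \<and> P n (s \<circ> r')"
      unfolding P_def convergent_def comp_def by blast
  qed
  define r where "r = diagseq"
  have r: "strict_mono r" by (simp add: r_def subseq_diagseq)
  define S where "S = {v. convergent (\<lambda>k. inner (x (r k)) v)}"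
  define L where "L v = lim (\<lambda>k. inner (x (r k)) v)" for v
  have lim: "(\<lambda>k. inner (x (r k)) v) \<longlonglongrightarrow> L v" if "v \<in> S" for v
    using that by (simp add: S_def L_def convergent_LIMSEQ_iff)
  have LI: "v \<in> S \<and> L v = l" if "(\<lambda>k. inner (x (r k)) v) \<longlonglongrightarrow> l" for v l
    using that by (auto simp: S_def L_def convergent_def limI)
  \<comment> \<open>The diagonal sequence has property \<open>P n\<close> only after a shift by
    \<open>Suc n\<close>, which does not affect convergence.\<close>
  have x_in_S: "x n \<in> S" for n
  proof -
    have "P n (diagseq \<circ> ((+) (Suc n)))"
    proof (rule diagseq_holds)
      fix r s :: "nat \<Rightarrow> nat" and n assume "strict_mono r" "P n s"
      then show "P n (s \<circ> r)"
        using convergent_subseq_convergent[of "\<lambda>k. inner (x (s k)) (x n)" r]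
        by (simp add: P_def comp_def)
    qed
    then have "convergent (\<lambda>k. inner (x (r (k + Suc n))) (x n))"
      by (simp add: P_def r_def add.commute)
    then show ?thesis
      unfolding S_def mem_Collect_eq
      using convergent_ignore_initial_segment[of "\<lambda>k. inner (x (r k)) (x n)" "Suc n"] by simp
  qed
  have add: "v + w \<in> S \<and> L (v + w) = L v + L w" if "v \<in> S" "w \<in> S" for v w
    using tendsto_add[OF lim[OF that(1)] lim[OF that(2)]] by (intro LI) (simp add: inner_add_right)
  have scale: "c *\<^sub>R v \<in> S \<and> L (c *\<^sub>R v) = c * L v" if "v \<in> S" for c v
    using tendsto_mult_left[OF lim[OF that], of c] by (intro LI) simp
  have "subspace S"
    using add scale LI[of 0 0] by (auto simp: subspace_def)
  have bounded: "\<bar>L v\<bar> \<le> M * norm v" if "v \<in> S" for v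
    using inner_le by (intro LIMSEQ_le_const2[OF tendsto_rabs[OF lim[OF that]]]) auto
  have "closed S"
    unfolding closed_sequential_limits
  proof (intro allI impI, elim conjE)
    fix v w assume v: "\<forall>n. v n \<in> S" and "v \<longlonglongrightarrow> w"
    have "Cauchy (\<lambda>k. inner (x (r k)) w)"
    proof (rule metric_CauchyI)
      fix e :: real assume "e > 0"
      have "(\<lambda>n. M * norm (v n - w)) \<longlonglongrightarrow> 0"
        using tendsto_mult_right_zero[OF tendsto_norm_zero[OF LIM_zero[OF \<open>v \<longlonglongrightarrow> w\<close>]]] .
      then have "\<forall>\<^sub>F n in sequentially. M * norm (v n - w) < e / 3"
        using \<open>e > 0\<close> by (intro order_tendstoD(2)) auto
      then obtain n where n: "M * norm (v n - w) < e / 3"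
        by (meson eventually_happens sequentially_bot)
      have near: "\<bar>inner (x k) w - inner (x k) (v n)\<bar> < e / 3" for k
        using inner_le[of k "v n - w"] n by (simp add: inner_diff_right abs_minus_commute)
      have "Cauchy (\<lambda>k. inner (x (r k)) (v n))"
        using lim v LIMSEQ_imp_Cauchy by blast
      from metric_CauchyD[OF this, of "e / 3"] \<open>e > 0\<close> obtain N where
        N: "\<forall>i\<ge>N. \<forall>k\<ge>N. \<bar>inner (x (r i)) (v n) - inner (x (r k)) (v n)\<bar> < e / 3"
        by (auto simp: dist_real_def)
      show "\<exists>N. \<forall>i\<ge>N. \<forall>k\<ge>N. dist (inner (x (r i)) w) (inner (x (r k)) w) < e"
      proof (intro exI allI impI)
        fix i k assume "i \<ge> N" "k \<ge> N"
        with N have "\<bar>inner (x (r i)) (v n) - inner (x (r k)) (v n)\<bar> < e / 3" by blast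
        with near[of "r i"] near[of "r k"]
        show "dist (inner (x (r i)) w) (inner (x (r k)) w) < e"
          unfolding dist_real_def by linarith
      qed
    qed
    then show "w \<in> S" by (simp add: S_def Cauchy_convergent)
  qed
  obtain l where l: "l \<in> S" "\<And>v. v \<in> S \<Longrightarrow> L v = inner l v"
    by (rule Riesz_closed_subspace[OF \<open>subspace S\<close> \<open>closed S\<close>, of L M])
      (use add scale bounded in auto)
  have "(\<lambda>k. inner (x (r k)) u) \<longlonglongrightarrow> inner l u" for u
  proof -
    \<comment> \<open>\<open>p\<close> is the orthogonal projection of \<open>u\<close> onto
      \<open>S\<close>. All \<open>x n\<close> lie in \<open>S\<close>, so they do not distinguish
      \<open>u\<close> from \<open>p\<close>.\<close>
    obtain p where p: "p \<in> S" "\<And>v. v \<in> S \<Longrightarrow> inner u v = inner p v"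
    proof (rule Riesz_closed_subspace[OF \<open>subspace S\<close> \<open>closed S\<close>, of "inner u" "norm u"])
      show "\<bar>inner u v\<bar> \<le> norm u * norm v" for v by (rule Cauchy_Schwarz_ineq2)
    qed (auto simp: inner_add_right)
    have "inner (x (r k)) u = inner (x (r k)) p" for k
      using p(2)[OF x_in_S, of "r k"] by (simp add: inner_commute)
    moreover have "inner l u = L p"
      using p l by (metis inner_commute)
    ultimately show ?thesis using lim[OF p(1)] by simp
  qed
  then show ?thesis using that[OF r, of l] by (simp add: weakly_tendsto_def)
qed

section \<open>Calculus of weak limits and Opial's lemma\<close>

lemma weakly_tendsto_unique:
  assumes "weakly_tendsto x l" "weakly_tendsto x l'"
  shows "l = l'"
proof -
  have "inner l v = inner l' v" for v
    using assms LIMSEQ_unique unfolding weakly_tendsto_def by blast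
  then show ?thesis by (metis vector_eq_rdot)
qed

lemma weakly_tendsto_subseq:
  assumes "weakly_tendsto x l" "strict_mono r"
  shows "weakly_tendsto (x \<circ> r) l"
  using assms LIMSEQ_subseq_LIMSEQ[of "\<lambda>k. inner (x k) v" for v]
  unfolding weakly_tendsto_def comp_def by blast

lemma weakly_tendsto_add:
  assumes "weakly_tendsto x l" "weakly_tendsto y l'"
  shows "weakly_tendsto (\<lambda>k. x k + y k) (l + l')"
  using assms unfolding weakly_tendsto_def by (auto simp: inner_add_left intro: tendsto_add)

lemma weakly_tendsto_scaleR:
  assumes "weakly_tendsto x l"
  shows "weakly_tendsto (\<lambda>k. c *\<^sub>R x k) (c *\<^sub>R l)"
  using assms unfolding weakly_tendsto_def by (auto intro: tendsto_mult_left)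

lemma tendsto_imp_weakly_tendsto:
  assumes "x \<longlonglongrightarrow> l"
  shows "weakly_tendsto x l"
  using assms unfolding weakly_tendsto_def by (auto intro: tendsto_intros)

lemma weakly_tendsto_vec_nth:
  assumes "weakly_tendsto x l"
  shows "weakly_tendsto (\<lambda>k. x k $ i) (l $ i)"
  unfolding weakly_tendsto_def
proof
  fix v
  have eq: "inner u (axis i v) = inner (u $ i) v" for u :: "'a ^ 'b"
    by (simp add: inner_vec_def axis_def if_distrib cong: if_cong)
  show "(\<lambda>k. inner (x k $ i) v) \<longlonglongrightarrow> inner (l $ i) v"
    using assms[unfolded weakly_tendsto_def, rule_format, of "axis i v"] by (simp only: eq)
qed

text \<open>If some inner product stayed away from its limit along a subsequence, boundedness would
  give a further weakly convergent subsequence, whose limit has to be \<open>l\<close>.\<close>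

lemma weakly_tendstoI_subseq:
  fixes x :: "nat \<Rightarrow> 'a::{real_inner, complete_space}"
  assumes bounded: "\<And>k. norm (x k) \<le> M"
    and unique: "\<And>r l'. strict_mono r \<Longrightarrow> weakly_tendsto (x \<circ> r) l' \<Longrightarrow> l' = l"
  shows "weakly_tendsto x l"
  unfolding weakly_tendsto_def
proof
  fix v
  show "(\<lambda>k. inner (x k) v) \<longlonglongrightarrow> inner l v"
  proof (rule ccontr)
    assume "\<not> ?thesis"
    then obtain e where "e > 0"
      and "\<not> (\<forall>\<^sub>F k in sequentially. dist (inner (x k) v) (inner l v) < e)"
      unfolding tendsto_iff by blast
    then have inf: "infinite {k. \<not> dist (inner (x k) v) (inner l v) < e}"
      by (simp add: not_eventually frequently_cofinite flip: cofinite_eq_sequentially)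
    obtain r :: "nat \<Rightarrow> nat"
      where r: "strict_mono r" "\<forall>k. r k \<in> {k. \<not> dist (inner (x k) v) (inner l v) < e}"
      using infinite_enumerate[OF inf] by blast
    obtain s l' where s: "strict_mono s" "weakly_tendsto ((x \<circ> r) \<circ> s) l'"
      using bounded_imp_weakly_convergent_subseq[of "x \<circ> r" M] bounded by auto
    have "l' = l"
      using unique[of "r \<circ> s" l'] r(1) s by (simp add: strict_mono_o comp_assoc)
    with s(2) have "(\<lambda>k. inner (x (r (s k))) v) \<longlonglongrightarrow> inner l v"
      by (simp add: weakly_tendsto_def)
    from tendstoD[OF this \<open>e > 0\<close>] r(2) show False by simp
  qed
qed

text \<open>For two weak cluster points p and q, the difference of the squared distances to them is
  affine in x_k and converges. Its limits along the two subsequences differ by 2 |p - q|^2, so p =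
  q.\<close>

lemma Opial:
  fixes x :: "nat \<Rightarrow> 'a::{real_inner, complete_space}"
  assumes bounded: "\<And>k. norm (x k) \<le> M"
    and conv: "\<And>p. p \<in> C \<Longrightarrow> convergent (\<lambda>k. norm (x k - p))"
    and cluster: "\<And>r p. strict_mono r \<Longrightarrow> weakly_tendsto (x \<circ> r) p \<Longrightarrow> p \<in> C"
  obtains p where "p \<in> C" "weakly_tendsto x p"
proof -
  obtain r p where r: "strict_mono r" "weakly_tendsto (x \<circ> r) p"
    using bounded_imp_weakly_convergent_subseq[of x M] bounded by auto
  have "p \<in> C" using cluster r by blast
  have "weakly_tendsto x p"
  proof (rule weakly_tendstoI_subseq[OF bounded])
    fix s q assume s: "strict_mono s" "weakly_tendsto (x \<circ> s) q"
    have "q \<in> C" using cluster s by blast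
    obtain Lp Lq where "(\<lambda>k. norm (x k - p)) \<longlonglongrightarrow> Lp" "(\<lambda>k. norm (x k - q)) \<longlonglongrightarrow> Lq"
      using conv[OF \<open>p \<in> C\<close>] conv[OF \<open>q \<in> C\<close>] unfolding convergent_def by blast
    then obtain L where L: "(\<lambda>k. (norm (x k - q))\<^sup>2 - (norm (x k - p))\<^sup>2) \<longlonglongrightarrow> L"
      by (intro that[of "Lq\<^sup>2 - Lp\<^sup>2"] tendsto_intros)
    have eq: "(norm (x k - q))\<^sup>2 - (norm (x k - p))\<^sup>2
        = 2 * inner (x k) (p - q) + (norm q)\<^sup>2 - (norm p)\<^sup>2" for k
      by (simp add: power2_norm_eq_inner algebra_simps inner_commute)
    have lim: "L = 2 * inner u (p - q) + (norm q)\<^sup>2 - (norm p)\<^sup>2"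
      if "strict_mono t" "weakly_tendsto (x \<circ> t) u" for t u
    proof (rule LIMSEQ_unique)
      show "(\<lambda>k. 2 * inner ((x \<circ> t) k) (p - q) + (norm q)\<^sup>2 - (norm p)\<^sup>2) \<longlonglongrightarrow> L"
        using LIMSEQ_subseq_LIMSEQ[OF L that(1)] by (simp add: comp_def eq)
      have "(\<lambda>k. inner ((x \<circ> t) k) (p - q)) \<longlonglongrightarrow> inner u (p - q)"
        using that(2) unfolding weakly_tendsto_def by blast
      then show "(\<lambda>k. 2 * inner ((x \<circ> t) k) (p - q) + (norm q)\<^sup>2 - (norm p)\<^sup>2)
          \<longlonglongrightarrow> 2 * inner u (p - q) + (norm q)\<^sup>2 - (norm p)\<^sup>2"
        by (intro tendsto_diff tendsto_add tendsto_mult tendsto_const)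
    qed
    have "inner (p - q) (p - q) = 0"
      using lim[OF r] lim[OF s] by (simp add: inner_diff_left)
    then show "q = p" by simp
  qed
  with \<open>p \<in> C\<close> show ?thesis using that by blast
qed

section \<open>Rates for decreasing summable sequences\<close>

lemma decseq_summable_imp_mult_tendsto_0:
  fixes q :: "nat \<Rightarrow> real"
  assumes "decseq q" "summable q" "\<And>k. 0 \<le> q k"
  shows "(\<lambda>k. real k * q k) \<longlonglongrightarrow> 0"
proof (rule metric_LIMSEQ_I)
  fix e :: real assume "e > 0"
  obtain N where N: "\<And>m n. m \<ge> N \<Longrightarrow> norm (sum q {m..<n}) < e / 2"
    using assms(2) \<open>e > 0\<close> unfolding summable_Cauchy by (meson half_gt_zero)
  show "\<exists>no. \<forall>k\<ge>no. dist (real k * q k) 0 < e"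
  proof (intro exI allI impI)
    \<comment> \<open>For k \<ge> 2 N, k is at most 2 (k - N), and monotonicity bounds (k - N) q_k
      by a piece of the series beyond N.\<close>
    fix k assume k: "k \<ge> 2 * N"
    have "real (k - N) * q k = (\<Sum>i\<in>{N..<k}. q k)" by simp
    also have "\<dots> \<le> sum q {N..<k}"
      using assms(1) by (intro sum_mono) (auto simp: decseq_def)
    also have "\<dots> < e / 2" using N[of N k] by simp
    finally have *: "real (k - N) * q k < e / 2" .
    have "real k * q k \<le> (2 * real (k - N)) * q k"
      using k assms(3) by (intro mult_right_mono) auto
    with * show "dist (real k * q k) 0 < e" using assms(3)[of k] by simp
  qed
qed

lemma norm_smallo_inverse_sqrt:
  fixes v :: "nat \<Rightarrow> 'a::real_normed_vector"
  assumes "decseq (\<lambda>k. norm (v k))" "summable (\<lambda>k. (norm (v k))\<^sup>2)"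
  shows "(\<lambda>k. norm (v k)) \<in> o(\<lambda>k. 1 / sqrt (real k))"
proof (rule smalloI_tendsto)
  have "decseq (\<lambda>k. (norm (v k))\<^sup>2)"
    using assms(1) by (auto simp: decseq_def intro: power_mono)
  from decseq_summable_imp_mult_tendsto_0[OF this assms(2)]
  have "(\<lambda>k. sqrt (real k * (norm (v k))\<^sup>2)) \<longlonglongrightarrow> sqrt 0"
    by (intro tendsto_real_sqrt) simp
  then show "(\<lambda>k. norm (v k) / (1 / sqrt (real k))) \<longlonglongrightarrow> 0"
    by (simp add: real_sqrt_mult mult.commute)
  \<comment> \<open>Only eventually: at k = 0 the comparison function is 1 / 0, which is 0.\<close>
  show "\<forall>\<^sub>F k in sequentially. 1 / sqrt (real k) \<noteq> 0"
    using eventually_gt_at_top[of 0] by eventually_elim simp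
qed


section \<open>The conditions on the parameters\<close>

text \<open>Completing the square in a with c = a + b held fixed: the vector in the last norm is (s
  + t) a minus a multiple of c. For s + t > 0 the coefficient of |c|^2 is therefore sharp.\<close>

lemma kappa_bound_identity:
  fixes a b :: "'a::real_inner"
  assumes "s + t \<noteq> 0" "\<gamma> + \<delta> \<noteq> 0"
  shows "s * (norm a)\<^sup>2 + t * (norm b)\<^sup>2 + \<gamma> * inner a (a + b) + \<delta> * inner b (a + b) =
    (\<gamma> + \<delta>) / 2 * kappa_bound s t \<gamma> \<delta> * (norm (a + b))\<^sup>2 +
    (norm (s *\<^sub>R a - t *\<^sub>R b + ((\<gamma> - \<delta>) / 2) *\<^sub>R (a + b)))\<^sup>2 / (s + t)"
proof -
  define p where "p = inner a a"
  define q where "q = inner a b"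
  define r where "r = inner b b"
  define D where "D = s + t"
  have "D \<noteq> 0" using assms by (simp add: D_def)
  have norms: "(norm a)\<^sup>2 = p" "(norm b)\<^sup>2 = r" "inner a (a + b) = p + q" "inner b (a + b) = q + r"
    "(norm (a + b))\<^sup>2 = p + 2 * q + r"
    by (simp_all add: power2_norm_eq_inner p_def q_def r_def algebra_simps inner_commute)
  define h where "h = (\<gamma> - \<delta>) / 2"
  have "s *\<^sub>R a - t *\<^sub>R b + h *\<^sub>R (a + b) = (s + h) *\<^sub>R a + (h - t) *\<^sub>R b"
    by (simp add: algebra_simps)
  then have n: "(norm (s *\<^sub>R a - t *\<^sub>R b + h *\<^sub>R (a + b)))\<^sup>2
      = (s + h)\<^sup>2 * p + 2 * (s + h) * (h - t) * q + (h - t)\<^sup>2 * r"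
    unfolding power2_norm_eq_inner p_def q_def r_def
    by (simp add: algebra_simps inner_commute power2_eq_square)
  have k: "(\<gamma> + \<delta>) / 2 * kappa_bound s t \<gamma> \<delta> = (4 * (\<gamma> + s) * (\<delta> + t) - (\<gamma> + \<delta>)\<^sup>2) / 4 / D"
    unfolding kappa_bound_def D_def using assms by (simp add: divide_simps) (simp add: algebra_simps)
  have "D * (s * p + t * r + \<gamma> * (p + q) + \<delta> * (q + r)) =
      (4 * (\<gamma> + s) * (\<delta> + t) - (\<gamma> + \<delta>)\<^sup>2) / 4 * (p + 2 * q + r) +
      ((s + h)\<^sup>2 * p + 2 * (s + h) * (h - t) * q + (h - t)\<^sup>2 * r)"
    by (simp add: D_def h_def power2_eq_square field_simps)
  moreover have "X = N / D * c + M / D" if "D * X = N * c + M" for X N c M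
    using that \<open>D \<noteq> 0\<close> by (simp add: nonzero_eq_divide_eq mult.commute flip: add_divide_distrib)
  ultimately show ?thesis
    unfolding norms n[unfolded h_def] k unfolding h_def[symmetric] D_def[symmetric] by blast
qed

text \<open>The gap between \<open>\<kappa>\<close> and the threshold gives a surplus e |a + b|^2.
  One half becomes the margin in |a + b|^2; the other half, with part of the completed square |d|^2
  / (s + t), pays for |a|^2, because (s + t) a = d + h (a + b).\<close>

lemma kappa_bound_margin:
  assumes "s + t > 0" "\<gamma> + \<delta> > 0" "\<kappa> < kappa_bound s t \<gamma> \<delta>"
  obtains \<epsilon> where "\<epsilon> > 0"
    "\<And>a b :: 'a::real_inner.
      (\<kappa> * (\<gamma> + \<delta>) / 2 + \<epsilon>) * (norm (a + b))\<^sup>2 + \<epsilon> * (norm a)\<^sup>2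
      \<le> s * (norm a)\<^sup>2 + t * (norm b)\<^sup>2 + \<gamma> * inner a (a + b) + \<delta> * inner b (a + b)"
proof -
  define D where "D = s + t"
  define h where "h = t - (\<gamma> - \<delta>) / 2"
  define e where "e = (\<gamma> + \<delta>) / 2 * (kappa_bound s t \<gamma> \<delta> - \<kappa>)"
  \<comment> \<open>The first bound keeps \<rho> |d|^2 within the available square, the second gives
    \<rho> h^2 \<le> e / 2; the added 1 allows h = 0.\<close>
  define \<rho> where "\<rho> = min (1 / D) (e / (2 * (h\<^sup>2 + 1)))"
  define \<epsilon> where "\<epsilon> = min (e / 2) (\<rho> * D\<^sup>2 / 2)"
  have "D > 0" using assms by (simp add: D_def)
  have "e > 0" using assms by (simp add: e_def)
  have h1: "h\<^sup>2 + 1 > 0" by (simp add: add_nonneg_pos)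
  have "\<rho> > 0" using \<open>D > 0\<close> \<open>e > 0\<close> h1 by (simp add: \<rho>_def)
  have "\<rho> * h\<^sup>2 \<le> e / (2 * (h\<^sup>2 + 1)) * (h\<^sup>2 + 1)"
    using \<open>e > 0\<close> h1 by (intro mult_mono) (auto simp: \<rho>_def)
  also have "\<dots> = e / 2" using h1 by (simp add: field_simps)
  finally have \<rho>h: "\<rho> * h\<^sup>2 \<le> e / 2" .
  have "\<epsilon> > 0" using \<open>e > 0\<close> \<open>\<rho> > 0\<close> \<open>D > 0\<close> by (simp add: \<epsilon>_def)
  moreover have "(\<kappa> * (\<gamma> + \<delta>) / 2 + \<epsilon>) * (norm (a + b))\<^sup>2 + \<epsilon> * (norm a)\<^sup>2
      \<le> s * (norm a)\<^sup>2 + t * (norm b)\<^sup>2 + \<gamma> * inner a (a + b) + \<delta> * inner b (a + b)"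
    for a b :: 'a
  proof -
    define d where "d = s *\<^sub>R a - t *\<^sub>R b + ((\<gamma> - \<delta>) / 2) *\<^sub>R (a + b)"
    have "D *\<^sub>R a = d + h *\<^sub>R (a + b)"
      by (simp add: D_def d_def h_def algebra_simps)
    then have "D\<^sup>2 * (norm a)\<^sup>2 = (norm (d + h *\<^sub>R (a + b)))\<^sup>2"
      using \<open>D > 0\<close> by (metis norm_scaleR power_mult_distrib power2_abs)
    also have "\<dots> \<le> 2 * (norm d)\<^sup>2 + 2 * (norm (h *\<^sub>R (a + b)))\<^sup>2"
    proof -
      have "(norm (d + h *\<^sub>R (a + b)))\<^sup>2 + (norm (d - h *\<^sub>R (a + b)))\<^sup>2
          = 2 * (norm d)\<^sup>2 + 2 * (norm (h *\<^sub>R (a + b)))\<^sup>2"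
        unfolding power2_norm_eq_inner by (simp add: inner_diff inner_add inner_commute)
      then show ?thesis using zero_le_power2[of "norm (d - h *\<^sub>R (a + b))"] by linarith
    qed
    finally have "D\<^sup>2 * (norm a)\<^sup>2 \<le> 2 * (norm d)\<^sup>2 + 2 * (h\<^sup>2 * (norm (a + b))\<^sup>2)"
      by (simp add: power_mult_distrib)
    then have "\<rho> * (D\<^sup>2 * (norm a)\<^sup>2) \<le> \<rho> * (2 * (norm d)\<^sup>2 + 2 * (h\<^sup>2 * (norm (a + b))\<^sup>2))"
      using \<open>\<rho> > 0\<close> by (intro mult_left_mono) auto
    moreover have "\<rho> * h\<^sup>2 * (norm (a + b))\<^sup>2 \<le> e / 2 * (norm (a + b))\<^sup>2"
      using \<rho>h by (intro mult_right_mono) auto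
    moreover have "\<rho> * (norm d)\<^sup>2 \<le> 1 / D * (norm d)\<^sup>2"
      by (intro mult_right_mono) (auto simp: \<rho>_def)
    moreover have "\<epsilon> * (norm (a + b))\<^sup>2 \<le> e / 2 * (norm (a + b))\<^sup>2"
      by (intro mult_right_mono) (auto simp: \<epsilon>_def)
    moreover have "\<epsilon> * (norm a)\<^sup>2 \<le> \<rho> * D\<^sup>2 / 2 * (norm a)\<^sup>2"
      by (intro mult_right_mono) (auto simp: \<epsilon>_def)
    moreover have "s * (norm a)\<^sup>2 + t * (norm b)\<^sup>2 + \<gamma> * inner a (a + b) + \<delta> * inner b (a + b)
        = (\<kappa> * (\<gamma> + \<delta>) / 2 + e) * (norm (a + b))\<^sup>2 + 1 / D * (norm d)\<^sup>2"
    proof -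
      have "\<kappa> * (\<gamma> + \<delta>) / 2 + e = (\<gamma> + \<delta>) / 2 * kappa_bound s t \<gamma> \<delta>"
        by (simp add: e_def field_simps)
      then show ?thesis
        using kappa_bound_identity[of s t \<gamma> \<delta> a b] assms by (simp add: D_def d_def)
    qed
    ultimately show ?thesis by (simp add: algebra_simps)
  qed
  ultimately show ?thesis using that by blast
qed

lemma kappa_bound_margin_uniform:
  fixes s t :: "'n::finite \<Rightarrow> real"
  assumes "\<And>i. s i + t i > 0" "\<gamma> + \<delta> > 0" "\<And>i. \<kappa> < kappa_bound (s i) (t i) \<gamma> \<delta>"
  obtains \<epsilon> where "\<epsilon> > 0"
    "\<And>i. \<And>a b :: 'a::real_inner.
      (\<kappa> * (\<gamma> + \<delta>) / 2 + \<epsilon>) * (norm (a + b))\<^sup>2 + \<epsilon> * (norm a)\<^sup>2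
      \<le> s i * (norm a)\<^sup>2 + t i * (norm b)\<^sup>2 + \<gamma> * inner a (a + b) + \<delta> * inner b (a + b)"
proof -
  have "\<exists>\<epsilon>>0. \<forall>a b :: 'a. (\<kappa> * (\<gamma> + \<delta>) / 2 + \<epsilon>) * (norm (a + b))\<^sup>2 + \<epsilon> * (norm a)\<^sup>2
      \<le> s i * (norm a)\<^sup>2 + t i * (norm b)\<^sup>2 + \<gamma> * inner a (a + b) + \<delta> * inner b (a + b)" for i
    using kappa_bound_margin[OF assms(1) assms(2) assms(3)] by metis
  then obtain e where e: "\<And>i. e i > 0"
    "\<And>i. \<And>a b :: 'a. (\<kappa> * (\<gamma> + \<delta>) / 2 + e i) * (norm (a + b))\<^sup>2 + e i * (norm a)\<^sup>2
      \<le> s i * (norm a)\<^sup>2 + t i * (norm b)\<^sup>2 + \<gamma> * inner a (a + b) + \<delta> * inner b (a + b)"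
    by metis
  show ?thesis
  proof (rule that[of "Min (range e)"])
    show "Min (range e) > 0" using e(1) by simp
    fix i and a b :: 'a
    have le: "Min (range e) \<le> e i" by simp
    have "(\<kappa> * (\<gamma> + \<delta>) / 2 + Min (range e)) * (norm (a + b))\<^sup>2 + Min (range e) * (norm a)\<^sup>2
        \<le> (\<kappa> * (\<gamma> + \<delta>) / 2 + e i) * (norm (a + b))\<^sup>2 + e i * (norm a)\<^sup>2"
      using le by (intro add_mono mult_right_mono) auto
    also note e(2)[of i a b]
    finally show "(\<kappa> * (\<gamma> + \<delta>) / 2 + Min (range e)) * (norm (a + b))\<^sup>2 + Min (range e) * (norm a)\<^sup>2
      \<le> s i * (norm a)\<^sup>2 + t i * (norm b)\<^sup>2 + \<gamma> * inner a (a + b) + \<delta> * inner b (a + b)" .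
  qed
qed

lemma parameter_margin:
  fixes \<sigma> :: "'n::finite \<Rightarrow> real"
  assumes pos: "\<gamma> > 0" "\<delta> > 0"
    and cond: "cond_C1 \<sigma> \<sigma>m \<gamma> \<delta> \<or> cond_C2 \<sigma> \<sigma>m \<gamma> \<delta> \<or> cond_C3 \<sigma> \<sigma>m \<gamma> \<delta> lam \<mu> \<kappa>"
    and \<kappa>: "\<kappa> < kappa_star \<sigma> \<sigma>m \<gamma> \<delta> lam \<mu> \<kappa>"
  obtains \<theta> \<epsilon> \<eta> where
    "\<And>i. \<theta> i > 0" "(\<Sum>i\<in>UNIV. 1 / \<theta> i) = 1"
    "\<And>i. \<sigma> i \<ge> 0" "\<And>i. \<sigma> i + \<sigma>m * \<theta> i \<ge> 0" "\<sigma>m \<le> 0"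
    "\<epsilon> > 0" "\<eta> \<ge> 0" "cond_C2 \<sigma> \<sigma>m \<gamma> \<delta> \<or> cond_C3 \<sigma> \<sigma>m \<gamma> \<delta> lam \<mu> \<kappa> \<Longrightarrow> \<eta> > 0"
    "\<And>i. \<And>a b :: 'a::real_inner.
      (\<kappa> * (\<gamma> + \<delta>) / 2 + \<epsilon>) * (norm (a + b))\<^sup>2 + \<eta> * (norm a)\<^sup>2
      \<le> \<sigma> i * (norm a)\<^sup>2 + \<sigma>m * \<theta> i * (norm b)\<^sup>2 + \<gamma> * inner a (a + b) + \<delta> * inner b (a + b)"
proof -
  let ?n = "real CARD('n)"
  let ?s = "Min (range \<sigma>)"
  have n: "?n > 0" by simp
  have s_le: "?s \<le> \<sigma> i" for i by simp
  have \<sigma>m: "\<sigma>m \<le> 0" if "- (?n * \<sigma>m) \<ge> 0"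
    using that n by (simp add: mult_le_0_iff)
  \<comment> \<open>C3 takes precedence: it may overlap with C1 or C2, \<open>\<eta>\<close> must be
    positive whenever it holds, and \<open>\<kappa>\<close> is then known to be below 1 but not
    below the C2 threshold.\<close>
  consider (C3) "cond_C3 \<sigma> \<sigma>m \<gamma> \<delta> lam \<mu> \<kappa>"
    | (C1) "\<not> cond_C3 \<sigma> \<sigma>m \<gamma> \<delta> lam \<mu> \<kappa>" "cond_C1 \<sigma> \<sigma>m \<gamma> \<delta>"
    | (C2) "\<not> cond_C3 \<sigma> \<sigma>m \<gamma> \<delta> lam \<mu> \<kappa>" "\<not> cond_C1 \<sigma> \<sigma>m \<gamma> \<delta>" "cond_C2 \<sigma> \<sigma>m \<gamma> \<delta>"
    using cond by blast
  then show ?thesis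
  proof cases
    case C3
    then obtain \<theta> where \<theta>: "\<theta> \<in> Theta \<sigma> \<sigma>m"
      "\<kappa> < Min (range (\<lambda>i. kappa_bound (\<sigma> i) (\<sigma>m * \<theta> i) \<gamma> \<delta>))"
      unfolding cond_C3_def by fastforce
    then have gap: "\<sigma> i + \<sigma>m * \<theta> i > 0" "\<kappa> < kappa_bound (\<sigma> i) (\<sigma>m * \<theta> i) \<gamma> \<delta>" for i
      by (auto simp: Theta_def)
    obtain \<epsilon> where \<epsilon>: "\<epsilon> > 0" "\<And>i. \<And>a b :: 'a.
      (\<kappa> * (\<gamma> + \<delta>) / 2 + \<epsilon>) * (norm (a + b))\<^sup>2 + \<epsilon> * (norm a)\<^sup>2
      \<le> \<sigma> i * (norm a)\<^sup>2 + \<sigma>m * \<theta> i * (norm b)\<^sup>2 + \<gamma> * inner a (a + b) + \<delta> * inner b (a + b)"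
      using kappa_bound_margin_uniform[of \<sigma> "\<lambda>i. \<sigma>m * \<theta> i" \<gamma> \<delta> \<kappa>] gap pos by auto
    show ?thesis
      by (rule that[of \<theta> \<epsilon> \<epsilon>])
        (use \<theta>(1) C3 \<epsilon> gap(1) in \<open>auto simp: Theta_def cond_C3_def intro: less_imp_le\<close>)
  next
    case C1
    then have "\<not> cond_C2 \<sigma> \<sigma>m \<gamma> \<delta>" "\<kappa> < 1" and s: "?s = - (?n * \<sigma>m)" "?s \<ge> 0" "\<delta> = \<gamma> + 2 * ?s"
      using \<kappa> by (auto simp: cond_C1_def cond_C2_def kappa_star_def)
    have coeff: "\<kappa> * (\<gamma> + \<delta>) / 2 + (1 - \<kappa>) * (\<gamma> + \<delta>) / 2 = (\<gamma> + \<delta>) / 2"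
      by (simp add: field_simps)
    have "(\<kappa> * (\<gamma> + \<delta>) / 2 + (1 - \<kappa>) * (\<gamma> + \<delta>) / 2) * (norm (a + b))\<^sup>2 + 0 * (norm a)\<^sup>2
        \<le> \<sigma> i * (norm a)\<^sup>2 + \<sigma>m * ?n * (norm b)\<^sup>2 + \<gamma> * inner a (a + b) + \<delta> * inner b (a + b)"
      for i and a b :: 'a
    proof -
      \<comment> \<open>With s = \<open>?s\<close>, s |a|^2 - s |b|^2 is the inner product of s (a -
        b) and a + b, and \<delta> = \<gamma> + 2 s makes \<gamma> + s and \<delta> - s both equal
        to (\<gamma> + \<delta>) / 2.\<close>
      have "(\<gamma> + \<delta>) / 2 * (norm (a + b))\<^sup>2
          = ?s * (norm a)\<^sup>2 - ?s * (norm b)\<^sup>2 + \<gamma> * inner a (a + b) + \<delta> * inner b (a + b)"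
        unfolding s(3) power2_norm_eq_inner by (simp add: algebra_simps inner_commute)
      moreover have "?s * (norm a)\<^sup>2 \<le> \<sigma> i * (norm a)\<^sup>2"
        using s_le by (intro mult_right_mono) auto
      moreover have "?s * (norm b)\<^sup>2 = - (\<sigma>m * ?n * (norm b)\<^sup>2)"
        unfolding s(1) by simp
      ultimately show ?thesis unfolding coeff by linarith
    qed
    moreover have "\<sigma> i \<ge> 0" "\<sigma> i + \<sigma>m * ?n \<ge> 0" for i
      using s_le[of i] s unfolding mult.commute[of \<sigma>m] by linarith+
    moreover have "(1 - \<kappa>) * (\<gamma> + \<delta>) / 2 > 0" "\<sigma>m \<le> 0"
      using \<open>\<kappa> < 1\<close> pos s \<sigma>m by simp_all
    \<comment> \<open>The constant weight \<open>CARD('n)\<close> is the one whose reciprocals sum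
      to 1; it turns the component modulus of G into (m - 1) \<sigma>m.\<close>
    ultimately show ?thesis
      using C1(1) \<open>\<not> cond_C2 \<sigma> \<sigma>m \<gamma> \<delta>\<close> n
      by (intro that[of "\<lambda>_. ?n" "(1 - \<kappa>) * (\<gamma> + \<delta>) / 2" 0]) (assumption | simp)+
  next
    case C2
    have bound: "\<kappa> < kappa_bound ?s (\<sigma>m * ?n) \<gamma> \<delta>"
      using \<kappa> C2 by (simp add: kappa_star_def mult.commute)
    have s: "?s + \<sigma>m * ?n > 0" "- (?n * \<sigma>m) \<ge> 0"
      using C2(3) unfolding cond_C2_def mult.commute[of \<sigma>m] by linarith+
    obtain \<epsilon> where \<epsilon>: "\<epsilon> > 0" "\<And>a b :: 'a.
      (\<kappa> * (\<gamma> + \<delta>) / 2 + \<epsilon>) * (norm (a + b))\<^sup>2 + \<epsilon> * (norm a)\<^sup>2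
      \<le> ?s * (norm a)\<^sup>2 + \<sigma>m * ?n * (norm b)\<^sup>2 + \<gamma> * inner a (a + b) + \<delta> * inner b (a + b)"
      using kappa_bound_margin[OF s(1) _ bound] pos by (metis add_pos_pos)
    have "(\<kappa> * (\<gamma> + \<delta>) / 2 + \<epsilon>) * (norm (a + b))\<^sup>2 + \<epsilon> * (norm a)\<^sup>2
      \<le> \<sigma> i * (norm a)\<^sup>2 + \<sigma>m * ?n * (norm b)\<^sup>2 + \<gamma> * inner a (a + b) + \<delta> * inner b (a + b)"
      for i and a b :: 'a
      using \<epsilon>(2)[of a b] mult_right_mono[OF s_le[of i], of "(norm a)\<^sup>2"] by simp
    moreover have "\<sigma> i \<ge> 0" "\<sigma> i + \<sigma>m * ?n \<ge> 0" for i
      using s_le[of i] s unfolding mult.commute[of \<sigma>m] by linarith+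
    ultimately show ?thesis
      using \<epsilon>(1) s \<sigma>m n by (intro that[of "\<lambda>_. ?n" \<epsilon> \<epsilon>]) auto
  qed
qed

text \<open>Cauchy-Schwarz after writing |b_i| as the product of 1 / sqrt \<theta>_i and sqrt
  \<theta>_i |b_i|.\<close>

lemma norm_sum_power2_le_weighted:
  fixes b :: "'n::finite \<Rightarrow> 'a::real_inner"
  assumes "\<And>i. \<theta> i > 0" "(\<Sum>i\<in>UNIV. 1 / \<theta> i) = 1"
  shows "(norm (\<Sum>i\<in>UNIV. b i))\<^sup>2 \<le> (\<Sum>i\<in>UNIV. \<theta> i * (norm (b i))\<^sup>2)"
proof -
  have "norm (\<Sum>i\<in>UNIV. b i) \<le> (\<Sum>i\<in>UNIV. (1 / sqrt (\<theta> i)) * (sqrt (\<theta> i) * norm (b i)))"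
    using assms(1) by (intro order_trans[OF norm_sum] sum_mono) (simp add: less_imp_neq[symmetric])
  then have "(norm (\<Sum>i\<in>UNIV. b i))\<^sup>2
      \<le> (\<Sum>i\<in>UNIV. (1 / sqrt (\<theta> i)) * (sqrt (\<theta> i) * norm (b i)))\<^sup>2"
    by (intro power_mono) auto
  also have "\<dots> \<le> (\<Sum>i\<in>UNIV. (1 / sqrt (\<theta> i))\<^sup>2) * (\<Sum>i\<in>UNIV. (sqrt (\<theta> i) * norm (b i))\<^sup>2)"
    by (rule Cauchy_Schwarz_ineq_sum)
  also have "\<dots> = (\<Sum>i\<in>UNIV. \<theta> i * (norm (b i))\<^sup>2)"
    using assms by (simp add: power_mult_distrib power_divide less_imp_le)
  finally show ?thesis .
qed

text \<open>If (y, a) is not in the graph, adding it breaks comonotonicity, and the violating pair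
  must involve (y, a) itself. If it is in the graph, it is its own witness with value 0. Treating
  both cases at once supplies a witness for every operator before any membership is known, so that
  the witness inequalities can be summed.\<close>

lemma maximal_comonotone_witness:
  assumes "maximal_comonotone \<sigma> A"
  obtains u \<alpha> where "\<alpha> \<in> A u" "inner (y - u) (a - \<alpha>) - \<sigma> * (norm (a - \<alpha>))\<^sup>2 \<le> 0"
    "a \<notin> A y \<Longrightarrow> inner (y - u) (a - \<alpha>) - \<sigma> * (norm (a - \<alpha>))\<^sup>2 < 0"
proof (cases "a \<in> A y")
  case True
  then show ?thesis by (intro that[of a y]) auto
next
  case False
  define B where "B = A(y := insert a (A y))"
  have gra_B: "gra B = insert (y, a) (gra A)"
    by (auto simp: gra_def B_def split: if_splits)
  have "gra A \<subset> gra B"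
    using False by (auto simp: gra_B) (auto simp: gra_def)
  then have "\<not> comonotone \<sigma> B" and A: "comonotone \<sigma> A"
    using assms unfolding maximal_comonotone_def by blast+
  then obtain u \<alpha> where "(u, \<alpha>) \<in> gra A"
    "inner (y - u) (a - \<alpha>) < \<sigma> * (norm (a - \<alpha>))\<^sup>2"
  proof -
    from \<open>\<not> comonotone \<sigma> B\<close> obtain u \<alpha> v \<beta> where uv: "(u, \<alpha>) \<in> gra B" "(v, \<beta>) \<in> gra B"
      "inner (u - v) (\<alpha> - \<beta>) < \<sigma> * (norm (\<alpha> - \<beta>))\<^sup>2"
      by (simp add: comonotone_def case_prod_beta not_le) (metis prod.collapse)
    have sym: "inner (v - u) (\<beta> - \<alpha>) < \<sigma> * (norm (\<beta> - \<alpha>))\<^sup>2"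
      using uv(3) by (metis inner_minus_left inner_minus_right minus_diff_eq minus_minus norm_minus_commute)
    show ?thesis
      using uv sym A that unfolding gra_B comonotone_def by fastforce
  qed
  then show ?thesis by (intro that[of \<alpha> u]) (auto simp: gra_def)
qed

text \<open>The normal cone supplies every vector with component sum 0, so b enters only through its
  sum, which must be the v of the diagonal part. Conversely, b minus its mean is a normal
  vector.\<close>

lemma mem_G_op_iff:
  fixes z :: "'a::real_inner ^ 'n"
  shows "b \<in> G_op Am z \<longleftrightarrow> z \<in> diagonal \<and> (\<forall>i. (\<Sum>j\<in>UNIV. b $ j) \<in> Am (z $ i))"
proof (cases "z \<in> diagonal")
  case True
  then obtain p where p: "\<And>i. z $ i = p" unfolding diagonal_def by blast
  have "b \<in> G_op Am z \<longleftrightarrow>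
      (\<exists>v\<in>Am p. \<exists>w. (\<Sum>i\<in>UNIV. w $ i) = 0 \<and> b = (\<chi> i. (1 / real CARD('n)) *\<^sub>R v) + w)"
    using True by (auto simp: G_op_def diagonal_op_def normal_cone_diagonal set_plus_def p)
  also have "\<dots> \<longleftrightarrow> (\<Sum>j\<in>UNIV. b $ j) \<in> Am p"
  proof
    assume "\<exists>v\<in>Am p. \<exists>w. (\<Sum>i\<in>UNIV. w $ i) = 0 \<and> b = (\<chi> i. (1 / real CARD('n)) *\<^sub>R v) + w"
    then show "(\<Sum>j\<in>UNIV. b $ j) \<in> Am p"
      by (auto simp: sum.distrib scaleR_right.sum[symmetric] sum_constant_scaleR)
  next
    assume *: "(\<Sum>j\<in>UNIV. b $ j) \<in> Am p"
    define v where "v = (\<Sum>j\<in>UNIV. b $ j)"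
    have "(\<Sum>i\<in>UNIV. (b - (\<chi> i. (1 / real CARD('n)) *\<^sub>R v)) $ i) = 0"
      by (simp add: sum_subtractf sum_constant_scaleR v_def[symmetric])
    then show "\<exists>v\<in>Am p. \<exists>w. (\<Sum>i\<in>UNIV. w $ i) = 0 \<and> b = (\<chi> i. (1 / real CARD('n)) *\<^sub>R v) + w"
      using * unfolding v_def[symmetric]
      by (intro bexI[of _ v] exI[of _ "b - (\<chi> i. (1 / real CARD('n)) *\<^sub>R v)"]) auto
  qed
  finally show ?thesis using True by (simp add: p)
next
  case False
  then show ?thesis by (simp add: G_op_def diagonal_op_def set_plus_def)
qed


section \<open>The Douglas-Rachford step\<close>

lemma summable_of_descent:
  fixes v w :: "nat \<Rightarrow> real"
  assumes "\<And>k. v (Suc k) \<le> v k - w k" "\<And>k. v k \<ge> 0" "\<And>k. w k \<ge> 0"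
  shows "summable w"
proof (rule bounded_imp_summable)
  show "(\<Sum>i\<le>n. w i) \<le> v 0" for n
  proof -
    have "(\<Sum>i\<le>n. w i) + v (Suc n) \<le> v 0"
    proof (induction n)
      case 0
      then show ?case using assms(1)[of 0] by simp
    next
      case (Suc n)
      then show ?case using assms(1)[of "Suc n"] by simp
    qed
    with assms(2)[of "Suc n"] show ?thesis by simp
  qed
qed (use assms(3) in auto)

lemma summable_power2_norm_imp_tendsto_0:
  fixes v :: "nat \<Rightarrow> 'a::real_normed_vector"
  assumes "summable (\<lambda>k. (norm (v k))\<^sup>2)"
  shows "v \<longlonglongrightarrow> 0"
proof (rule tendsto_norm_zero_cancel)
  show "(\<lambda>k. norm (v k)) \<longlonglongrightarrow> 0"
    using tendsto_real_sqrt[OF summable_LIMSEQ_zero[OF assms]] by simp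
qed

lemma power2_norm_vec: "(norm (x :: 'a::real_inner ^ 'n))\<^sup>2 = (\<Sum>i\<in>UNIV. (norm (x $ i))\<^sup>2)"
  by (simp add: power2_norm_eq_inner inner_vec_def)

lemma tendsto_inner_bounded_null:
  fixes x y :: "nat \<Rightarrow> 'a::real_inner"
  assumes "x \<longlonglongrightarrow> 0" "\<And>k. norm (y k) \<le> M"
  shows "(\<lambda>k. inner (x k) (y k)) \<longlonglongrightarrow> 0" "(\<lambda>k. inner (y k) (x k)) \<longlonglongrightarrow> 0"
proof -
  show "(\<lambda>k. inner (x k) (y k)) \<longlonglongrightarrow> 0"
  proof (rule Lim_null_comparison)
    have "norm (inner (x k) (y k)) \<le> norm (x k) * M" for k
      using Cauchy_Schwarz_ineq2[of "x k" "y k"] mult_left_mono[OF assms(2)[of k] norm_ge_zero[of "x k"]]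
      by simp
    then show "\<forall>\<^sub>F k in sequentially. norm (inner (x k) (y k)) \<le> norm (x k) * M" by simp
    show "(\<lambda>k. norm (x k) * M) \<longlonglongrightarrow> 0"
      using tendsto_mult_left_zero[OF tendsto_norm_zero[OF assms(1)]] .
  qed
  then show "(\<lambda>k. inner (y k) (x k)) \<longlonglongrightarrow> 0" by (simp add: inner_commute)
qed

text \<open>A step of the algorithm at \<open>x\<close>, written in terms of the dual variables
  \<open>a = (x - y) / \<gamma> \<in> F y\<close> and \<open>b \<in> G z\<close>; then \<open>y = x - \<gamma> a\<close> and \<open>z = y - \<delta> (a + b)\<close>.\<close>

definition DR_step ::
    "real \<Rightarrow> real \<Rightarrow> 'a::real_vector operator \<Rightarrow> 'a operator \<Rightarrow> 'a \<Rightarrow> 'a \<Rightarrow> 'a \<Rightarrow> bool" where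
  "DR_step \<gamma> \<delta> F G x a b \<longleftrightarrow>
    a \<in> F (x - \<gamma> *\<^sub>R a) \<and> b \<in> G (x - \<gamma> *\<^sub>R a - \<delta> *\<^sub>R (a + b))"

section \<open>Resolvents and fixed points in dual variables\<close>

lemma mem_resolvent_iff: "y \<in> resolvent \<gamma> F x \<longleftrightarrow> (\<exists>a. a \<in> F y \<and> y = x - \<gamma> *\<^sub>R a)"
  by (auto simp: resolvent_def algebra_simps)

lemma relaxed_resolvent_eq:
  "relaxed_resolvent lam \<gamma> F x = {x - (lam * \<gamma>) *\<^sub>R a | a. a \<in> F (x - \<gamma> *\<^sub>R a)}"
proof -
  have "lam *\<^sub>R (x - \<gamma> *\<^sub>R a) + (1 - lam) *\<^sub>R x = x - (lam * \<gamma>) *\<^sub>R a" for a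
    by (simp add: algebra_simps)
  moreover have "resolvent \<gamma> F x = (\<lambda>a. x - \<gamma> *\<^sub>R a) ` {a. a \<in> F (x - \<gamma> *\<^sub>R a)}"
    by (auto simp: mem_resolvent_iff)
  ultimately show ?thesis
    by (simp add: relaxed_resolvent_def image_image setcompr_eq_image)
qed

text \<open>With y = x - \<gamma> a, the relation \<delta> = \<gamma> (lam - 1) makes the argument
  of the second resolvent equal to y - \<delta> a.\<close>

lemma DR_step_of_resolvents:
  assumes "\<delta> = \<gamma> * (lam - 1)"
    and "y \<in> resolvent \<gamma> F x" "z \<in> resolvent \<delta> G ((1 - lam) *\<^sub>R x + lam *\<^sub>R y)"
  obtains a b where "DR_step \<gamma> \<delta> F G x a b" "y = x - \<gamma> *\<^sub>R a" "z = y - \<delta> *\<^sub>R (a + b)"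
proof -
  obtain a where a: "a \<in> F y" "y = x - \<gamma> *\<^sub>R a"
    using assms(2) by (auto simp: mem_resolvent_iff)
  obtain b where b: "b \<in> G z" "z = (1 - lam) *\<^sub>R x + lam *\<^sub>R y - \<delta> *\<^sub>R b"
    using assms(3) by (auto simp: mem_resolvent_iff)
  have "z = y - \<delta> *\<^sub>R (a + b)"
    unfolding b(2) unfolding a(2) assms(1) by (simp add: algebra_simps)
  then show ?thesis using a b that[of a b] by (simp add: DR_step_def)
qed

text \<open>The parameter relations give lam \<gamma> = \<mu> \<delta> = \<gamma> + \<delta>. Both
  relaxed resolvents thus subtract the same multiple of their dual vector.\<close>

lemma adaptive_DR_eq:
  assumes "\<gamma> > 0" "\<delta> > 0" "(lam - 1) * (\<mu> - 1) = 1" "\<delta> = \<gamma> * (lam - 1)"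
  shows "adaptive_DR \<kappa> \<gamma> \<delta> lam \<mu> F G x =
    {x - (\<kappa> * (\<gamma> + \<delta>)) *\<^sub>R (a + b) | a b. DR_step \<gamma> \<delta> F G x a b}"
proof -
  have lam: "lam * \<gamma> = \<gamma> + \<delta>" using assms(4) by (simp add: algebra_simps)
  have "\<delta> * (\<mu> - 1) = \<gamma>" using assms(3,4) by (metis mult.assoc mult.right_neutral)
  then have \<mu>: "\<mu> * \<delta> = \<gamma> + \<delta>" by (simp add: algebra_simps)
  have arg: "x - (\<gamma> + \<delta>) *\<^sub>R a - \<delta> *\<^sub>R b = x - \<gamma> *\<^sub>R a - \<delta> *\<^sub>R (a + b)" for a b
    by (simp add: algebra_simps)
  have val: "(1 - \<kappa>) *\<^sub>R x + \<kappa> *\<^sub>R (x - (\<gamma> + \<delta>) *\<^sub>R a - (\<gamma> + \<delta>) *\<^sub>R b)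
      = x - (\<kappa> * (\<gamma> + \<delta>)) *\<^sub>R (a + b)" for a b
    by (simp add: algebra_simps)
  show ?thesis
    unfolding adaptive_DR_def relaxed_resolvent_eq lam \<mu> DR_step_def
    by (auto simp: arg val image_iff) (metis arg val)+
qed

lemma Fix_adaptive_DR:
  assumes "\<gamma> > 0" "\<delta> > 0" "\<kappa> > 0" "(lam - 1) * (\<mu> - 1) = 1" "\<delta> = \<gamma> * (lam - 1)"
  shows "x \<in> Fix (adaptive_DR \<kappa> \<gamma> \<delta> lam \<mu> F G) \<longleftrightarrow> (\<exists>a. DR_step \<gamma> \<delta> F G x a (- a))"
proof -
  have "\<kappa> * (\<gamma> + \<delta>) \<noteq> 0" using assms by simp
  then have "x = x - (\<kappa> * (\<gamma> + \<delta>)) *\<^sub>R (a + b) \<longleftrightarrow> b = - a" for a b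
    by (simp add: eq_neg_iff_add_eq_0 add.commute)
  then show ?thesis
    by (simp add: Fix_def adaptive_DR_eq[OF assms(1,2,4,5)])
qed

lemma DR_step_fixed_iff:
  "DR_step \<gamma> \<delta> F G x a (- a) \<longleftrightarrow> a \<in> F (x - \<gamma> *\<^sub>R a) \<and> - a \<in> G (x - \<gamma> *\<^sub>R a)"
  by (simp add: DR_step_def)

lemma mem_zer_plus_iff:
  fixes F G :: "'a::ab_group_add operator"
  shows "p \<in> zer (\<lambda>v. F v + G v) \<longleftrightarrow> (\<exists>a. a \<in> F p \<and> - a \<in> G p)"
  by (auto simp: zer_def set_plus_def eq_neg_iff_add_eq_0 add.commute)
    (metis add.commute eq_neg_iff_add_eq_0 ab_left_minus)+

text \<open>The conditions C1, C2 and C3 enter only through \<open>\<theta>\<close>, \<open>\<epsilon>\<close>, \<open>\<eta>\<close>: \<open>\<theta>\<close> is constantly \<open>m - 1\<close> under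
  C1 and C2 and an element of \<open>\<Theta>\<close> under C3, and \<open>\<eta>\<close> is positive unless only C1 holds.\<close>

locale DR_splitting =
  fixes A :: "'n::finite \<Rightarrow> 'a::{real_inner, complete_space} operator"
    and Am :: "'a operator"
    and \<sigma> \<theta> :: "'n \<Rightarrow> real" and \<sigma>m \<gamma> \<delta> \<kappa> \<epsilon> \<eta> :: real
  assumes maximal: "\<And>i. maximal_comonotone (\<sigma> i) (A i)" "maximal_comonotone \<sigma>m Am"
    and \<theta>: "\<And>i. \<theta> i > 0" "(\<Sum>i\<in>UNIV. 1 / \<theta> i) = 1"
    and \<sigma>: "\<And>i. \<sigma> i \<ge> 0" "\<And>i. \<sigma> i + \<sigma>m * \<theta> i \<ge> 0" "\<sigma>m \<le> 0"
    and pos: "\<gamma> > 0" "\<delta> > 0" "\<kappa> > 0" "\<epsilon> > 0" "\<eta> \<ge> 0"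
    and margin: "\<And>i. \<And>a b :: 'a.
      (\<kappa> * (\<gamma> + \<delta>) / 2 + \<epsilon>) * (norm (a + b))\<^sup>2 + \<eta> * (norm a)\<^sup>2
      \<le> \<sigma> i * (norm a)\<^sup>2 + \<sigma>m * \<theta> i * (norm b)\<^sup>2 + \<gamma> * inner a (a + b) + \<delta> * inner b (a + b)"
begin

abbreviation F :: "('a ^ 'n) operator" where "F \<equiv> product_op A"
abbreviation G :: "('a ^ 'n) operator" where "G \<equiv> G_op Am"
abbreviation step :: "'a ^ 'n \<Rightarrow> 'a ^ 'n \<Rightarrow> 'a ^ 'n \<Rightarrow> bool" where "step \<equiv> DR_step \<gamma> \<delta> F G"
abbreviation \<tau> :: real where "\<tau> \<equiv> \<kappa> * (\<gamma> + \<delta>)"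

section \<open>Estimates for a pair of steps\<close>

lemma \<tau>_pos: "\<tau> > 0" using pos by simp

lemma A_comonotone:
  assumes "u \<in> A i p" "u' \<in> A i p'"
  shows "\<sigma> i * (norm (u - u'))\<^sup>2 \<le> inner (p - p') (u - u')"
  using maximal(1)[of i] assms by (force simp: maximal_comonotone_def comonotone_def gra_def)

lemma Am_comonotone:
  assumes "u \<in> Am p" "u' \<in> Am p'"
  shows "\<sigma>m * (norm (u - u'))\<^sup>2 \<le> inner (p - p') (u - u')"
  using maximal(2) assms by (force simp: maximal_comonotone_def comonotone_def gra_def)

lemma F_comonotone:
  assumes "a \<in> F y" "a' \<in> F y'"
  shows "(\<Sum>i\<in>UNIV. \<sigma> i * (norm ((a - a') $ i))\<^sup>2) \<le> inner (y - y') (a - a')"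
  unfolding inner_vec_def using assms
  by (intro sum_mono) (auto simp: product_op_def intro: A_comonotone)

text \<open>\<open>Am\<close> controls only the sum of the components. Because \<sigma>m \<le> 0,
  multiplying the weighted Cauchy-Schwarz inequality by it reverses the direction, which yields a
  lower bound split by components like that of F.\<close>

lemma G_comonotone:
  assumes "b \<in> G z" "b' \<in> G z'"
  shows "(\<Sum>i\<in>UNIV. \<sigma>m * \<theta> i * (norm ((b - b') $ i))\<^sup>2) \<le> inner (z - z') (b - b')"
proof -
  obtain p p' where p: "\<And>i. z $ i = p" "\<And>i. z' $ i = p'"
    using assms by (simp add: mem_G_op_iff diagonal_def) metis
  define c where "c = (\<Sum>i\<in>UNIV. (b - b') $ i)"
  have "c = (\<Sum>i\<in>UNIV. b $ i) - (\<Sum>i\<in>UNIV. b' $ i)" by (simp add: c_def sum_subtractf)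
  then have "\<sigma>m * (norm c)\<^sup>2 \<le> inner (p - p') c"
    using assms by (simp add: mem_G_op_iff p Am_comonotone)
  also have "inner (p - p') c = inner (z - z') (b - b')"
    by (simp add: inner_vec_def p c_def inner_sum_right)
  finally have "\<sigma>m * (norm c)\<^sup>2 \<le> inner (z - z') (b - b')" .
  moreover have "\<sigma>m * (\<Sum>i\<in>UNIV. \<theta> i * (norm ((b - b') $ i))\<^sup>2) \<le> \<sigma>m * (norm c)\<^sup>2"
    unfolding c_def using norm_sum_power2_le_weighted[OF \<theta>] \<sigma>(3) by (intro mult_left_mono_neg)
  ultimately show ?thesis by (simp add: sum_distrib_left mult.assoc)
qed

text \<open>Adding the inequalities of F and G to the margin gives a lower bound (\<tau> / 2 +
  \<epsilon>) |C|^2 + \<eta> |P|^2 for the inner product of X and C. The part with \<tau> / 2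
  cancels \<tau>^2 |C|^2 in the expanded square. Any two steps are allowed, so the estimate serves
  both for a fixed point and for consecutive iterates.\<close>

lemma step_contraction:
  assumes "step x a b" "step x' a' b'"
  shows "(norm ((x - \<tau> *\<^sub>R (a + b)) - (x' - \<tau> *\<^sub>R (a' + b'))))\<^sup>2
    \<le> (norm (x - x'))\<^sup>2 - 2 * \<tau> * (\<epsilon> * (norm ((a + b) - (a' + b')))\<^sup>2 + \<eta> * (norm (a - a'))\<^sup>2)"
proof -
  define X where "X = x - x'"
  define P where "P = a - a'"
  define Q where "Q = b - b'"
  define C where "C = P + Q"
  have C: "C = (a + b) - (a' + b')" by (simp add: C_def P_def Q_def)
  have F: "(\<Sum>i\<in>UNIV. \<sigma> i * (norm (P $ i))\<^sup>2) \<le> inner (X - \<gamma> *\<^sub>R P) P"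
  proof -
    have "X - \<gamma> *\<^sub>R P = (x - \<gamma> *\<^sub>R a) - (x' - \<gamma> *\<^sub>R a')"
      by (simp add: X_def P_def algebra_simps)
    then show ?thesis
      using assms F_comonotone[of a "x - \<gamma> *\<^sub>R a" a' "x' - \<gamma> *\<^sub>R a'"] by (simp add: DR_step_def P_def)
  qed
  have G: "(\<Sum>i\<in>UNIV. \<sigma>m * \<theta> i * (norm (Q $ i))\<^sup>2) \<le> inner (X - \<gamma> *\<^sub>R P - \<delta> *\<^sub>R C) Q"
  proof -
    have "X - \<gamma> *\<^sub>R P - \<delta> *\<^sub>R C
        = (x - \<gamma> *\<^sub>R a - \<delta> *\<^sub>R (a + b)) - (x' - \<gamma> *\<^sub>R a' - \<delta> *\<^sub>R (a' + b'))"
      by (simp add: X_def P_def C algebra_simps)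
    then show ?thesis
      using assms G_comonotone[of b "x - \<gamma> *\<^sub>R a - \<delta> *\<^sub>R (a + b)" b' "x' - \<gamma> *\<^sub>R a' - \<delta> *\<^sub>R (a' + b')"]
      by (simp add: DR_step_def Q_def)
  qed
  have "(\<tau> / 2 + \<epsilon>) * (norm C)\<^sup>2 + \<eta> * (norm P)\<^sup>2
      = (\<Sum>i\<in>UNIV. (\<tau> / 2 + \<epsilon>) * (norm (P $ i + Q $ i))\<^sup>2 + \<eta> * (norm (P $ i))\<^sup>2)"
    by (simp add: power2_norm_vec sum.distrib sum_distrib_left C_def)
  also have "\<dots> \<le> (\<Sum>i\<in>UNIV. \<sigma> i * (norm (P $ i))\<^sup>2 + \<sigma>m * \<theta> i * (norm (Q $ i))\<^sup>2
      + \<gamma> * inner (P $ i) (P $ i + Q $ i) + \<delta> * inner (Q $ i) (P $ i + Q $ i))"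
    by (intro sum_mono margin)
  also have "\<dots> = (\<Sum>i\<in>UNIV. \<sigma> i * (norm (P $ i))\<^sup>2) + (\<Sum>i\<in>UNIV. \<sigma>m * \<theta> i * (norm (Q $ i))\<^sup>2)
      + \<gamma> * inner P C + \<delta> * inner Q C"
    by (simp add: sum.distrib sum_distrib_left inner_vec_def C_def)
  also have "\<dots> \<le> inner (X - \<gamma> *\<^sub>R P) P + inner (X - \<gamma> *\<^sub>R P - \<delta> *\<^sub>R C) Q
      + \<gamma> * inner P C + \<delta> * inner Q C"
    using F G by linarith
  \<comment> \<open>The correction terms -\<gamma> P and -\<delta> C of the base points are exactly
    what the last two summands restore.\<close>
  also have "\<dots> = inner X C"
    by (simp add: C_def algebra_simps inner_commute)
  finally have "2 * \<tau> * ((\<tau> / 2 + \<epsilon>) * (norm C)\<^sup>2 + \<eta> * (norm P)\<^sup>2) \<le> 2 * \<tau> * inner X C"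
    using \<tau>_pos by (intro mult_left_mono) auto
  moreover have "(norm (X - \<tau> *\<^sub>R C))\<^sup>2 = (norm X)\<^sup>2 - 2 * \<tau> * inner X C + \<tau>\<^sup>2 * (norm C)\<^sup>2"
  proof -
    have "(norm (X - t *\<^sub>R C))\<^sup>2 = (norm X)\<^sup>2 - 2 * t * inner X C + t\<^sup>2 * (norm C)\<^sup>2" for t
      unfolding power2_norm_eq_inner by (simp add: algebra_simps inner_commute power2_eq_square)
    then show ?thesis .
  qed
  moreover have "2 * t * ((t / 2 + \<epsilon>) * c + \<eta> * p) = t\<^sup>2 * c + 2 * t * (\<epsilon> * c + \<eta> * p)" for t c p
    by (simp add: algebra_simps power2_eq_square)
  ultimately have "(norm (X - \<tau> *\<^sub>R C))\<^sup>2
      \<le> (norm X)\<^sup>2 - 2 * \<tau> * (\<epsilon> * (norm C)\<^sup>2 + \<eta> * (norm P)\<^sup>2)"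
    by simp
  moreover have "(x - \<tau> *\<^sub>R (a + b)) - (x' - \<tau> *\<^sub>R (a' + b')) = X - \<tau> *\<^sub>R C"
    by (simp add: X_def C scaleR_diff_right)
  ultimately show ?thesis by (simp only: C X_def P_def)
qed

text \<open>Nonnegative moduli make F monotone, so the cross term in |Y + \<gamma> P|^2 is
  nonnegative and both squares are bounded by |x - x'|^2.\<close>

lemma resolvent_F_nonexpansive:
  assumes "a \<in> F (x - \<gamma> *\<^sub>R a)" "a' \<in> F (x' - \<gamma> *\<^sub>R a')"
  shows "norm ((x - \<gamma> *\<^sub>R a) - (x' - \<gamma> *\<^sub>R a')) \<le> norm (x - x')"
    and "\<gamma> * norm (a - a') \<le> norm (x - x')"
proof -
  define Y where "Y = (x - \<gamma> *\<^sub>R a) - (x' - \<gamma> *\<^sub>R a')"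
  define P where "P = a - a'"
  have "0 \<le> (\<Sum>i\<in>UNIV. \<sigma> i * (norm (P $ i))\<^sup>2)"
    using \<sigma>(1) by (intro sum_nonneg) auto
  also have "\<dots> \<le> inner Y P"
    unfolding Y_def P_def by (rule F_comonotone[OF assms])
  finally have "2 * \<gamma> * inner Y P \<ge> 0" using pos by simp
  moreover have "x - x' = Y + \<gamma> *\<^sub>R P"
    by (simp add: Y_def P_def algebra_simps)
  then have "(norm (x - x'))\<^sup>2 = (norm Y)\<^sup>2 + 2 * \<gamma> * inner Y P + (norm (\<gamma> *\<^sub>R P))\<^sup>2"
    unfolding power2_norm_eq_inner by (simp add: algebra_simps inner_commute)
  ultimately have "(norm Y)\<^sup>2 \<le> (norm (x - x'))\<^sup>2" "(norm (\<gamma> *\<^sub>R P))\<^sup>2 \<le> (norm (x - x'))\<^sup>2"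
    by simp_all
  then have "norm Y \<le> norm (x - x')" "norm (\<gamma> *\<^sub>R P) \<le> norm (x - x')"
    by (simp_all add: power2_le_iff_abs_le)
  then show "norm ((x - \<gamma> *\<^sub>R a) - (x' - \<gamma> *\<^sub>R a')) \<le> norm (x - x')"
    and "\<gamma> * norm (a - a') \<le> norm (x - x')"
    using pos by (simp_all add: Y_def P_def)
qed

end


section \<open>Weak limits and convergence\<close>

text \<open>This is the form left over when the comonotonicity inequalities are added in the limit b
  = - a: weighted Cauchy-Schwarz reduces it to the coefficients \<sigma>_i + \<sigma>m
  \<theta>_i.\<close>

lemma (in DR_splitting) quadratic_form_nonneg:
  "0 \<le> (\<Sum>i\<in>UNIV. \<sigma> i * (norm (v i :: 'a))\<^sup>2) + \<sigma>m * (norm (\<Sum>i\<in>UNIV. v i))\<^sup>2"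
proof -
  have "0 \<le> (\<Sum>i\<in>UNIV. (\<sigma> i + \<sigma>m * \<theta> i) * (norm (v i))\<^sup>2)"
    using \<sigma>(2) by (intro sum_nonneg) auto
  also have "\<dots> = (\<Sum>i\<in>UNIV. \<sigma> i * (norm (v i))\<^sup>2) + \<sigma>m * (\<Sum>i\<in>UNIV. \<theta> i * (norm (v i))\<^sup>2)"
    by (simp add: sum.distrib sum_distrib_left algebra_simps)
  also have "\<sigma>m * (\<Sum>i\<in>UNIV. \<theta> i * (norm (v i))\<^sup>2) \<le> \<sigma>m * (norm (\<Sum>i\<in>UNIV. v i))\<^sup>2"
    using norm_sum_power2_le_weighted[OF \<theta>] \<sigma>(3) by (intro mult_left_mono_neg)
  finally show ?thesis by simp
qed

text \<open>The quadratic parts of the comonotonicity inequalities have the wrong sign for a passage to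
  the weak limit in each operator separately, but their sum is a nonnegative quadratic form.
  Hence the limit is related to the graphs of all operators simultaneously, and by maximality
  no single operator can have a strictly violating graph point.\<close>

lemma (in DR_splitting) weak_limit_graphs:
  fixes y z a b :: "nat \<Rightarrow> 'a ^ 'n"
  assumes F: "\<And>k. a k \<in> F (y k)" and G: "\<And>k. b k \<in> G (z k)"
    and y: "weakly_tendsto y p" and a: "weakly_tendsto a a'"
    and yz: "(\<lambda>k. y k - z k) \<longlonglongrightarrow> 0" and ab: "(\<lambda>k. a k + b k) \<longlonglongrightarrow> 0"
    and bounded: "\<And>k. norm (a k) \<le> M" "\<And>k. norm (z k) \<le> M"
  shows "a' \<in> F p \<and> - a' \<in> G p"
proof -
  have z: "weakly_tendsto z p"
    using weakly_tendsto_add[OF y weakly_tendsto_scaleR[OF tendsto_imp_weakly_tendsto[OF yz], of "-1"]]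
    by simp
  have z_diag: "z k $ i = z k $ j" for k i j
    using G[of k] by (simp add: mem_G_op_iff diagonal_def)
  have p_diag: "p $ i = p $ j" for i j
  proof (rule weakly_tendsto_unique)
    show "weakly_tendsto (\<lambda>k. z k $ i) (p $ i)" by (rule weakly_tendsto_vec_nth[OF z])
    show "weakly_tendsto (\<lambda>k. z k $ i) (p $ j)"
      using weakly_tendsto_vec_nth[OF z, of j] z_diag by (metis (no_types, lifting) ext)
  qed
  obtain i0 :: 'n where True by simp
  define q where "q = p $ i0"
  have p: "p $ i = q" for i using p_diag by (simp add: q_def)
  define v where "v = (\<Sum>i\<in>UNIV. a' $ i)"
  have "\<forall>i. \<exists>u \<alpha>. \<alpha> \<in> A i u \<and> inner (q - u) (a' $ i - \<alpha>) - \<sigma> i * (norm (a' $ i - \<alpha>))\<^sup>2 \<le> 0 \<and>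
      (a' $ i \<notin> A i q \<longrightarrow> inner (q - u) (a' $ i - \<alpha>) - \<sigma> i * (norm (a' $ i - \<alpha>))\<^sup>2 < 0)"
    using maximal_comonotone_witness[OF maximal(1)] by metis
  then obtain u \<alpha> where u: "\<And>i. \<alpha> i \<in> A i (u i)"
    "\<And>i. inner (q - u i) (a' $ i - \<alpha> i) - \<sigma> i * (norm (a' $ i - \<alpha> i))\<^sup>2 \<le> 0"
    "\<And>i. a' $ i \<notin> A i q \<Longrightarrow> inner (q - u i) (a' $ i - \<alpha> i) - \<sigma> i * (norm (a' $ i - \<alpha> i))\<^sup>2 < 0"
    by metis
  \<comment> \<open>\<open>- v\<close> is the weak limit of the component sums of b_k, since a_k +
    b_k tends to 0.\<close>
  obtain w \<beta> where w: "\<beta> \<in> Am w" "inner (q - w) (- v - \<beta>) - \<sigma>m * (norm (- v - \<beta>))\<^sup>2 \<le> 0"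
    "- v \<notin> Am q \<Longrightarrow> inner (q - w) (- v - \<beta>) - \<sigma>m * (norm (- v - \<beta>))\<^sup>2 < 0"
    using maximal_comonotone_witness[OF maximal(2)] by metis
  define E where "E i = inner (q - u i) (a' $ i - \<alpha> i) - \<sigma> i * (norm (a' $ i - \<alpha> i))\<^sup>2" for i
  define Em where "Em = inner (q - w) (- v - \<beta>) - \<sigma>m * (norm (- v - \<beta>))\<^sup>2"
  define U where "U i = q - u i" for i
  define L where "L i = a' $ i - \<alpha> i" for i
  define W where "W = q - w"
  define B where "B = - v - \<beta>"
  define Y where "Y k i = y k $ i - q" for k i
  define P where "P k i = a k $ i - a' $ i" for k i
  define Z where "Z k = z k $ i0 - q" for k
  define C where "C k = (\<Sum>i\<in>UNIV. (a k + b k) $ i)" for k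
  define SP where "SP k = (\<Sum>i\<in>UNIV. P k i)" for k
  define S where "S k = C k - SP k" for k
  define D where "D k = inner (y k - z k) (a k - a') + inner (z k - p) (a k + b k)" for k
  \<comment> \<open>Everything expected to vanish: inner products of weakly null sequences with
    fixed vectors, and products with a strongly null factor.\<close>
  define R where "R k = D k
      + (\<Sum>i\<in>UNIV. inner (Y k i) (L i) + inner (P k i) (U i) - 2 * \<sigma> i * inner (P k i) (L i))
      + inner (Z k) B + inner (S k) W - 2 * \<sigma>m * inner (S k) B
      - \<sigma>m * (inner (C k) (C k) - 2 * inner (C k) (SP k))" for k
  have SP_eq: "SP k = (\<Sum>i\<in>UNIV. (a k - a') $ i)" for k
    by (simp add: SP_def P_def)
  \<comment> \<open>The left side pairs sequences that are only weakly null. Since y_k and z_k share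
    a limit and b_k nearly cancels a_k, it regroups into products with one strongly null and one
    bounded factor.\<close>
  have D_eq: "(\<Sum>i\<in>UNIV. inner (Y k i) (P k i)) + inner (Z k) (S k) = D k" for k
  proof -
    have "(\<Sum>i\<in>UNIV. inner (Y k i) (P k i)) = inner (y k - p) (a k - a')"
      by (simp add: inner_vec_def Y_def P_def p)
    moreover have "inner (Z k) (S k) = inner (z k - p) ((a k + b k) - (a k - a'))"
    proof -
      have "S k = (\<Sum>i\<in>UNIV. ((a k + b k) - (a k - a')) $ i)"
        by (simp only: S_def C_def SP_eq vector_minus_component sum_subtractf)
      moreover have "(z k - p) $ i = Z k" for i
        using z_diag[of k i i0] by (simp add: Z_def p)
      ultimately show ?thesis by (simp only: inner_vec_def inner_sum_right)
    qed
    ultimately show ?thesis by (simp add: D_def algebra_simps)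
  qed
  have nonneg: "0 \<le> (\<Sum>i\<in>UNIV. E i) + Em + R k" for k
  proof -
    have "0 \<le> inner (Y k i + U i) (P k i + L i) - \<sigma> i * (norm (P k i + L i))\<^sup>2" for i
    proof -
      have "a k $ i \<in> A i (y k $ i)" using F by (simp add: product_op_def)
      from A_comonotone[OF this u(1)] show ?thesis by (simp add: Y_def U_def P_def L_def)
    qed
    then have "0 \<le> (\<Sum>i\<in>UNIV. inner (Y k i + U i) (P k i + L i) - \<sigma> i * (norm (P k i + L i))\<^sup>2)"
      by (intro sum_nonneg)
    also have "\<dots> = (\<Sum>i\<in>UNIV. E i + (inner (Y k i) (P k i) - \<sigma> i * (norm (P k i))\<^sup>2 +
        (inner (Y k i) (L i) + inner (P k i) (U i) - 2 * \<sigma> i * inner (P k i) (L i))))"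
      unfolding E_def U_def[symmetric] L_def[symmetric] power2_norm_eq_inner
      by (intro sum.cong) (simp_all add: algebra_simps inner_commute)
    also have "\<dots> = (\<Sum>i\<in>UNIV. E i) + (\<Sum>i\<in>UNIV. inner (Y k i) (P k i)) - (\<Sum>i\<in>UNIV. \<sigma> i * (norm (P k i))\<^sup>2)
        + (\<Sum>i\<in>UNIV. inner (Y k i) (L i) + inner (P k i) (U i) - 2 * \<sigma> i * inner (P k i) (L i))"
      by (simp add: sum.distrib sum_subtractf)
    finally have 1: "0 \<le> \<dots>" .
    have "(\<Sum>j\<in>UNIV. b k $ j) \<in> Am (z k $ i0)" using G by (simp add: mem_G_op_iff)
    moreover have "(\<Sum>j\<in>UNIV. b k $ j) - \<beta> = S k + B"
      by (simp add: S_def C_def SP_eq B_def v_def sum.distrib sum_subtractf)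
    moreover have "z k $ i0 - w = Z k + W" by (simp add: Z_def W_def)
    ultimately have "0 \<le> inner (Z k + W) (S k + B) - \<sigma>m * (norm (S k + B))\<^sup>2"
      using Am_comonotone[OF _ w(1)] by force
    also have "\<dots> = Em + inner (Z k) (S k) + inner (Z k) B + inner (S k) W
        - 2 * \<sigma>m * inner (S k) B - \<sigma>m * (norm (S k))\<^sup>2"
      unfolding Em_def W_def[symmetric] B_def[symmetric] power2_norm_eq_inner
      by (simp add: algebra_simps inner_commute)
    also have "(norm (S k))\<^sup>2 = (norm (SP k))\<^sup>2 + (inner (C k) (C k) - 2 * inner (C k) (SP k))"
      unfolding S_def power2_norm_eq_inner by (simp add: algebra_simps inner_commute)
    finally have 2: "0 \<le> Em + inner (Z k) (S k) + inner (Z k) B + inner (S k) W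
        - 2 * \<sigma>m * inner (S k) B
        - \<sigma>m * ((norm (SP k))\<^sup>2 + (inner (C k) (C k) - 2 * inner (C k) (SP k)))" .
    \<comment> \<open>The quadratic terms of 1 and 2 combine to the negative of this form and can be
      discarded; separately they have no usable sign.\<close>
    have "0 \<le> (\<Sum>i\<in>UNIV. \<sigma> i * (norm (P k i))\<^sup>2) + \<sigma>m * (norm (SP k))\<^sup>2"
      unfolding SP_def by (rule quadratic_form_nonneg)
    with 1 2 show ?thesis
      unfolding R_def D_eq[symmetric] distrib_left[of \<sigma>m] by linarith
  qed
  have weak_null: "(\<lambda>k. inner (x k - l) c) \<longlonglongrightarrow> 0" if "weakly_tendsto x l" for x and l c :: 'a
    using that[unfolded weakly_tendsto_def, rule_format, of c]
    by (simp add: inner_diff_left LIM_zero)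
  have lim_Y: "(\<lambda>k. inner (Y k i) c) \<longlonglongrightarrow> 0" for i c
    using weak_null[OF weakly_tendsto_vec_nth[OF y, of i]] by (simp add: Y_def p)
  have lim_P: "(\<lambda>k. inner (P k i) c) \<longlonglongrightarrow> 0" for i c
    using weak_null[OF weakly_tendsto_vec_nth[OF a, of i]] by (simp add: P_def)
  have lim_Z: "(\<lambda>k. inner (Z k) c) \<longlonglongrightarrow> 0" for c
    using weak_null[OF weakly_tendsto_vec_nth[OF z, of i0]] by (simp add: Z_def p)
  have lim_C: "C \<longlonglongrightarrow> 0"
  proof -
    have "C \<longlonglongrightarrow> (\<Sum>i\<in>UNIV. (0 :: 'a ^ 'n) $ i)"
      unfolding C_def using ab by (intro tendsto_sum tendsto_vec_nth)
    then show ?thesis by simp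
  qed
  have lim_S: "(\<lambda>k. inner (S k) c) \<longlonglongrightarrow> 0" for c
  proof -
    have "(\<lambda>k. inner (C k) c - (\<Sum>i\<in>UNIV. inner (P k i) c)) \<longlonglongrightarrow> inner 0 c - (\<Sum>i\<in>(UNIV :: 'n set). 0)"
      by (intro tendsto_diff tendsto_inner lim_C tendsto_const tendsto_sum lim_P)
    then show ?thesis by (simp add: S_def SP_def inner_diff_left inner_sum_left)
  qed
  have lim_CC: "(\<lambda>k. inner (C k) (C k)) \<longlonglongrightarrow> 0"
    using tendsto_inner[OF lim_C lim_C] by simp
  have bounded_a: "norm (a k - a') \<le> M + norm a'" for k
    using norm_triangle_ineq4[of "a k" a'] bounded(1)[of k] by linarith
  have bounded_z: "norm (z k - p) \<le> M + norm p" for k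
    using norm_triangle_ineq4[of "z k" p] bounded(2)[of k] by linarith
  have "norm (SP k) \<le> real CARD('n) * (M + norm a')" for k
  proof -
    have "norm (SP k) \<le> (\<Sum>i\<in>(UNIV :: 'n set). M + norm a')"
      unfolding SP_eq using Finite_Cartesian_Product.norm_nth_le[of "a k - a'"] bounded_a[of k]
      by (intro sum_norm_le) (meson order_trans)
    then show ?thesis by simp
  qed
  then have lim_CSP: "(\<lambda>k. inner (C k) (SP k)) \<longlonglongrightarrow> 0"
    by (rule tendsto_inner_bounded_null(1)[OF lim_C])
  have lim_D: "D \<longlonglongrightarrow> 0"
    unfolding D_def
    using tendsto_add[OF tendsto_inner_bounded_null(1)[OF yz bounded_a]
        tendsto_inner_bounded_null(2)[OF ab bounded_z]] by simp
  have "R \<longlonglongrightarrow> 0 + (\<Sum>i\<in>UNIV. 0 + 0 - 2 * \<sigma> i * 0) + 0 + 0 - 2 * \<sigma>m * 0 - \<sigma>m * (0 - 2 * 0)"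
    unfolding R_def
    by (intro tendsto_add tendsto_diff tendsto_mult tendsto_sum tendsto_const
        lim_D lim_Y lim_P lim_Z lim_S lim_CC lim_CSP)
  then have "(\<lambda>k. (\<Sum>i\<in>UNIV. E i) + Em + R k) \<longlonglongrightarrow> (\<Sum>i\<in>UNIV. E i) + Em + 0"
    by (intro tendsto_add tendsto_const) simp
  then have sum_nonneg: "0 \<le> (\<Sum>i\<in>UNIV. E i) + Em"
    using nonneg LIMSEQ_le_const[of _ "(\<Sum>i\<in>UNIV. E i) + Em + 0" 0] by auto
  \<comment> \<open>Nonpositive numbers with nonnegative sum all vanish, and a vanishing witness
    value excludes the strict inequality that non-membership would give.\<close>
  have E_le: "E i \<le> 0" "Em \<le> 0" for i using u(2) w(2) by (simp_all add: E_def Em_def)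
  then have "(\<Sum>i\<in>UNIV. E i) \<le> 0" by (intro sum_nonpos)
  with sum_nonneg E_le(2) have "Em = 0" "(\<Sum>i\<in>UNIV. E i) = 0" by linarith+
  then have "\<forall>i. E i = 0"
    using sum_nonneg_eq_0_iff[of UNIV "\<lambda>i. - E i"] E_le(1) by (simp add: sum_negf)
  then have "a' $ i \<in> A i q" for i using u(3)[of i] by (auto simp: E_def)
  then have "a' \<in> F p" by (simp add: product_op_def p)
  moreover have "- v \<in> Am q" using w(3) \<open>Em = 0\<close> by (auto simp: Em_def)
  then have "- a' \<in> G p"
    by (simp add: mem_G_op_iff diagonal_def p v_def sum_negf)
  ultimately show ?thesis ..
qed

text \<open>A substitute for demiclosedness of Id - T. It tracks the weak limit of the dual vectors
  as well, because T is treated as a relation and the limit step needs its own dual vector.\<close>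

lemma (in DR_splitting) step_fixed_of_weak_limits:
  assumes step: "\<And>k. step (x k) (a k) (b k)"
    and x: "weakly_tendsto x l" and a: "weakly_tendsto a a'"
    and ab: "(\<lambda>k. a k + b k) \<longlonglongrightarrow> 0"
    and bounded: "\<And>k. norm (x k) \<le> M" "\<And>k. norm (a k) \<le> M" "\<And>k. norm (a k + b k) \<le> M"
  shows "step l a' (- a')"
  unfolding DR_step_fixed_iff
proof (rule weak_limit_graphs)
  show "a k \<in> F (x k - \<gamma> *\<^sub>R a k)" "b k \<in> G (x k - \<gamma> *\<^sub>R a k - \<delta> *\<^sub>R (a k + b k))" for k
    using step by (simp_all add: DR_step_def)
  show "weakly_tendsto (\<lambda>k. x k - \<gamma> *\<^sub>R a k) (l - \<gamma> *\<^sub>R a')"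
    using weakly_tendsto_add[OF x weakly_tendsto_scaleR[OF a, of "- \<gamma>"]] by simp
  show "(\<lambda>k. (x k - \<gamma> *\<^sub>R a k) - (x k - \<gamma> *\<^sub>R a k - \<delta> *\<^sub>R (a k + b k))) \<longlonglongrightarrow> 0"
    using tendsto_scaleR[OF tendsto_const ab, of \<delta>] by simp
  show "norm (a k) \<le> M + \<gamma> * M + \<delta> * M" for k
    using bounded(2)[of k] order_trans[OF norm_ge_zero bounded(1)] pos by (simp add: add_increasing2)
  show "norm (x k - \<gamma> *\<^sub>R a k - \<delta> *\<^sub>R (a k + b k)) \<le> M + \<gamma> * M + \<delta> * M" for k
  proof -
    have "norm (x k - \<gamma> *\<^sub>R a k - \<delta> *\<^sub>R (a k + b k))
        \<le> norm (x k) + norm (\<gamma> *\<^sub>R a k) + norm (\<delta> *\<^sub>R (a k + b k))"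
      by (meson norm_triangle_ineq4 order_trans add_right_mono)
    also have "\<dots> \<le> M + \<gamma> * M + \<delta> * M"
      using bounded[of k] pos by (intro add_mono) auto
    finally show ?thesis .
  qed
qed (use a ab in auto)

text \<open>At one and the same x, the Lipschitz bound for the dual vector of F suffices.\<close>

lemma (in DR_splitting) step_fixed_unique:
  assumes "step x a (- a)" "step x a' (- a')"
  shows "a = a'"
  using resolvent_F_nonexpansive(2)[of a x a' x] assms pos by (simp add: DR_step_def mult_le_0_iff)

text \<open>For two fixed points the contraction leaves their distance unchanged, so the margin
  vanishes; its \<eta> part forces equal dual vectors.\<close>

lemma (in DR_splitting) step_fixed_dual_unique:
  assumes "\<eta> > 0" "step x a (- a)" "step x' a' (- a')"
  shows "a = a'"
proof -
  have "2 * \<tau> * (\<eta> * (norm (a - a'))\<^sup>2) \<le> 0"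
    using step_contraction[OF assms(2,3)] by simp
  moreover have "2 * \<tau> * (\<eta> * (norm (a - a'))\<^sup>2) > 0" if "a \<noteq> a'"
    using that pos assms(1) by (intro mult_pos_pos add_pos_pos) auto
  ultimately show ?thesis by fastforce
qed

section \<open>Convergence of the iterates\<close>

lemma (in DR_splitting) convergence:
  fixes x a b :: "nat \<Rightarrow> 'a ^ 'n"
  assumes step: "\<And>k. step (x k) (a k) (b k)"
    and x_Suc: "\<And>k. x (Suc k) = x k - \<tau> *\<^sub>R (a k + b k)"
    and ex: "step f af (- af)"
  obtains xbar abar where
    "step xbar abar (- abar)" "weakly_tendsto x xbar" "weakly_tendsto a abar"
    "(\<lambda>k. a k + b k) \<longlonglongrightarrow> 0"
    "(\<lambda>k. norm (x k - x (Suc k))) \<in> o(\<lambda>k. 1 / sqrt (real k))"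
    "(\<lambda>k. norm ((x k - \<gamma> *\<^sub>R a k) - (x (Suc k) - \<gamma> *\<^sub>R a (Suc k)))) \<in> o(\<lambda>k. 1 / sqrt (real k))"
    "\<eta> > 0 \<Longrightarrow> a \<longlonglongrightarrow> abar"
proof -
  define c where "c k = a k + b k" for k
  have descent: "(norm (x (Suc k) - g))\<^sup>2
      \<le> (norm (x k - g))\<^sup>2 - 2 * \<tau> * (\<epsilon> * (norm (c k))\<^sup>2 + \<eta> * (norm (a k - ag))\<^sup>2)"
    if "step g ag (- ag)" for g ag k
    using step_contraction[OF step[of k] that] by (simp add: x_Suc c_def)
  have nonneg: "0 \<le> 2 * \<tau> * (\<epsilon> * (norm (c k))\<^sup>2 + \<eta> * (norm (a k - ag))\<^sup>2)" for k ag
    using \<tau>_pos pos by (intro mult_nonneg_nonneg add_nonneg_nonneg) auto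
  have "summable (\<lambda>k. 2 * \<tau> * (\<epsilon> * (norm (c k))\<^sup>2 + \<eta> * (norm (a k - ag))\<^sup>2))"
    if "step g ag (- ag)" for g ag
    by (rule summable_of_descent[of "\<lambda>k. (norm (x k - g))\<^sup>2"]) (use descent[OF that] nonneg in simp_all)
  then have summable: "summable (\<lambda>k. \<epsilon> * (norm (c k))\<^sup>2 + \<eta> * (norm (a k - ag))\<^sup>2)"
    if "step g ag (- ag)" for g ag
    by (rule summable_mult_D[of "2 * \<tau>"]) (use that \<tau>_pos in auto)
  have Fejer: "norm (x (Suc k) - g) \<le> norm (x k - g)" if "step g ag (- ag)" for g ag k
  proof -
    have "(norm (x (Suc k) - g))\<^sup>2 \<le> (norm (x k - g))\<^sup>2"
      using descent[OF that, of k] nonneg[of k ag] by linarith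
    then show ?thesis by (simp add: power2_le_iff_abs_le)
  qed
  have x_near: "norm (x k - f) \<le> norm (x 0 - f)" for k
    by (induction k) (use Fejer[OF ex] order_trans in blast)+
  have convergent: "convergent (\<lambda>k. norm (x k - g))" if "step g ag (- ag)" for g ag
  proof (rule decseq_convergent[of _ 0])
    show "decseq (\<lambda>k. norm (x k - g))" using Fejer[OF that] by (simp add: decseq_Suc_iff)
  qed (auto simp: convergent_def)
  have summable_c: "summable (\<lambda>k. (norm (c k))\<^sup>2)"
  proof (rule summable_mult_D)
    show "summable (\<lambda>k. \<epsilon> * (norm (c k))\<^sup>2)"
      by (rule summable_comparison_test'[OF summable[OF ex]]) (use pos in simp)
  qed (use pos in simp)
  then have c_lim: "c \<longlonglongrightarrow> 0"
    by (rule summable_power2_norm_imp_tendsto_0)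
  have x_diff: "x k - x (Suc k) = \<tau> *\<^sub>R c k" for k by (simp add: x_Suc c_def)
  \<comment> \<open>Here the contraction compares step k with step k + 1, not with a fixed
    point.\<close>
  have dec: "decseq (\<lambda>k. norm (x k - x (Suc k)))"
    unfolding decseq_Suc_iff
  proof
    fix k
    have "(norm (x (Suc k) - x (Suc (Suc k))))\<^sup>2 \<le> (norm (x k - x (Suc k)))\<^sup>2"
    proof -
      have "0 \<le> 2 * \<tau> * (\<epsilon> * (norm ((a k + b k) - (a (Suc k) + b (Suc k))))\<^sup>2
          + \<eta> * (norm (a k - a (Suc k)))\<^sup>2)"
        using \<tau>_pos pos by (intro mult_nonneg_nonneg add_nonneg_nonneg) auto
      then show ?thesis
        using step_contraction[OF step[of k] step[of "Suc k"]]
        unfolding x_Suc[symmetric] by linarith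
    qed
    then show "norm (x (Suc k) - x (Suc (Suc k))) \<le> norm (x k - x (Suc k))"
      by (simp add: power2_le_iff_abs_le)
  qed
  have rate_x: "(\<lambda>k. norm (x k - x (Suc k))) \<in> o(\<lambda>k. 1 / sqrt (real k))"
  proof (rule norm_smallo_inverse_sqrt[OF dec])
    show "summable (\<lambda>k. (norm (x k - x (Suc k)))\<^sup>2)"
      unfolding x_diff norm_scaleR power_mult_distrib by (rule summable_mult[OF summable_c])
  qed
  \<comment> \<open>Each y_k is the image of x_k under the nonexpansive resolvent of F, so its
    increments inherit the rate.\<close>
  have "(\<lambda>k. norm ((x k - \<gamma> *\<^sub>R a k) - (x (Suc k) - \<gamma> *\<^sub>R a (Suc k))))
      \<in> O(\<lambda>k. norm (x k - x (Suc k)))"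
    using step by (intro bigoI[of _ 1] always_eventually allI)
      (simp add: resolvent_F_nonexpansive(1) DR_step_def)
  from landau_o.big_small_trans[OF this rate_x]
  have rate_y: "(\<lambda>k. norm ((x k - \<gamma> *\<^sub>R a k) - (x (Suc k) - \<gamma> *\<^sub>R a (Suc k))))
      \<in> o(\<lambda>k. 1 / sqrt (real k))" .
  define M1 where "M1 = norm (x 0 - f) + norm f"
  define M2 where "M2 = norm (x 0 - f) / \<gamma> + norm af"
  have x_bdd: "norm (x k) \<le> M1" for k
    using x_near[of k] norm_triangle_sub[of "x k" f] by (simp add: M1_def)
  have a_bdd: "norm (a k) \<le> M2" for k
  proof -
    have "\<gamma> * norm (a k - af) \<le> norm (x k - f)"
      using step[of k] ex by (intro resolvent_F_nonexpansive(2)) (simp_all add: DR_step_def)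
    also note x_near
    finally have "norm (a k - af) \<le> norm (x 0 - f) / \<gamma>"
      using pos by (simp add: field_simps)
    then show ?thesis using norm_triangle_sub[of "a k" af] by (simp add: M2_def)
  qed
  obtain M3 where c_bdd: "\<And>k. norm (c k) \<le> M3"
    using convergent_imp_bounded[OF c_lim] by (auto simp: bounded_iff)
  define M where "M = max M1 (max M2 M3)"
  have cluster: "step l l' (- l')"
    if "strict_mono r" "weakly_tendsto (x \<circ> r) l" "weakly_tendsto (a \<circ> r) l'" for r l l'
  proof (rule step_fixed_of_weak_limits[OF _ that(2,3)])
    show "step ((x \<circ> r) k) ((a \<circ> r) k) ((b \<circ> r) k)" for k using step by simp
    show "(\<lambda>k. (a \<circ> r) k + (b \<circ> r) k) \<longlonglongrightarrow> 0"
      using LIMSEQ_subseq_LIMSEQ[OF c_lim that(1)] by (simp add: c_def comp_def)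
    show "norm ((x \<circ> r) k) \<le> M" "norm ((a \<circ> r) k) \<le> M" "norm ((a \<circ> r) k + (b \<circ> r) k) \<le> M" for k
      using x_bdd[of "r k"] a_bdd[of "r k"] c_bdd[of "r k"] by (simp_all add: M_def c_def le_max_iff_disj)
  qed
  obtain xbar where xbar: "xbar \<in> {g. \<exists>ag. step g ag (- ag)}" "weakly_tendsto x xbar"
  proof (rule Opial[of x M1 "{g. \<exists>ag. step g ag (- ag)}"])
    \<comment> \<open>A cluster point of x alone does not determine a dual vector, so a further
      subsequence is taken along which a converges weakly too.\<close>
    fix r p assume r: "strict_mono r" "weakly_tendsto (x \<circ> r) p"
    obtain s l where s: "strict_mono s" "weakly_tendsto ((a \<circ> r) \<circ> s) l"
      using bounded_imp_weakly_convergent_subseq[of "a \<circ> r" M2] a_bdd by auto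
    have "step p l (- l)"
      using cluster[of "r \<circ> s"] strict_mono_o[OF r(1) s(1)] s(2) weakly_tendsto_subseq[OF r(2) s(1)]
      by (simp add: comp_assoc)
    then show "p \<in> {g. \<exists>ag. step g ag (- ag)}" by blast
  qed (use x_bdd convergent in auto)
  then obtain abar where abar: "step xbar abar (- abar)" by blast
  \<comment> \<open>Every weak cluster point of a is a dual vector for the same limit
    \<open>xbar\<close>, and there is only one.\<close>
  have "weakly_tendsto a abar"
  proof (rule weakly_tendstoI_subseq[OF a_bdd])
    fix r l assume "strict_mono r" "weakly_tendsto (a \<circ> r) l"
    then have "step xbar l (- l)"
      using cluster weakly_tendsto_subseq[OF xbar(2)] by blast
    with abar show "l = abar" using step_fixed_unique by blast
  qed
  moreover have "a \<longlonglongrightarrow> abar" if "\<eta> > 0"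
  proof -
    have "summable (\<lambda>k. (norm (a k - abar))\<^sup>2)"
    proof (rule summable_mult_D)
      show "summable (\<lambda>k. \<eta> * (norm (a k - abar))\<^sup>2)"
        by (rule summable_comparison_test'[OF summable[OF abar]]) (use pos in simp)
    qed (use that in simp)
    then show ?thesis
      by (rule LIM_zero_cancel[OF summable_power2_norm_imp_tendsto_0])
  qed
  ultimately show ?thesis
    using that[OF abar xbar(2)] c_lim[unfolded c_def[abs_def]] rate_x rate_y by blast
qed

text \<open>A zero p of the sum with selected values s_i in A_i p gives the dual vector (s_i), whose
  component sum is minus the selected value of \<open>Am\<close>. Shifting the diagonal point p by
  \<gamma> times this vector gives the fixed point.\<close>

lemma (in DR_splitting) step_fixed_exists:
  assumes "zer (\<lambda>p. (\<Sum>i\<in>UNIV. A i p) + Am p) \<noteq> {}"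
  obtains x a where "step x a (- a)"
proof -
  obtain p s v where s: "\<And>i. s i \<in> A i p" "v \<in> Am p" "0 = (\<Sum>i\<in>UNIV. s i) + v"
    using assms by (auto simp: zer_def set_plus_def set_sum_alt)
  define a where "a = (\<chi> i. s i)"
  define x where "x = (\<chi> i. p) + \<gamma> *\<^sub>R a"
  have "- (\<Sum>i\<in>UNIV. s i) = v" using minus_unique[OF s(3)[symmetric]] .
  then have "a \<in> F (x - \<gamma> *\<^sub>R a)" "- a \<in> G (x - \<gamma> *\<^sub>R a)"
    using s(1,2) by (simp_all add: product_op_def mem_G_op_iff diagonal_def x_def a_def sum_negf)
  then show ?thesis using that[of x a] by (simp add: DR_step_fixed_iff)
qed

text \<open>The fixed step itself provides an element of the resolvent, and the Lipschitz bound for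
  dual vectors excludes a second one.\<close>

lemma (in DR_splitting) resolvent_F_fixed:
  assumes "step x a (- a)"
  shows "resolvent \<gamma> F x = {x - \<gamma> *\<^sub>R a}"
proof -
  have a: "a \<in> F (x - \<gamma> *\<^sub>R a)" using assms by (simp add: DR_step_def)
  have "a' = a" if "a' \<in> F (x - \<gamma> *\<^sub>R a')" for a'
    using resolvent_F_nonexpansive(2)[OF that a] pos by (simp add: mult_le_0_iff)
  with a have "y \<in> resolvent \<gamma> F x \<longleftrightarrow> y = x - \<gamma> *\<^sub>R a" for y
    unfolding mem_resolvent_iff by metis
  then show ?thesis by blast
qed

lemma mem_singleton_plus_iff:
  fixes c :: "'a::ab_group_add"
  shows "f \<in> {c} + S \<longleftrightarrow> f - c \<in> S"
proof
  assume "f - c \<in> S"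
  then have "c + (f - c) \<in> {c} + S" by (intro set_plus_intro) auto
  then show "f \<in> {c} + S" by simp
qed (auto simp: set_plus_def)

theorem theorem4p12:
  fixes A :: "'n::finite \<Rightarrow> 'a::{real_inner, complete_space} operator"
    and Am :: "'a operator"
    and \<sigma> :: "'n \<Rightarrow> real" and \<sigma>m :: real
    and \<gamma> \<delta> lam \<mu> \<kappa> :: real
    and x y z :: "nat \<Rightarrow> 'a ^ 'n"
    and F G T :: "('a ^ 'n) operator"
  defines "F \<equiv> product_op A"
    and "G \<equiv> G_op Am"
    and "T \<equiv> adaptive_DR \<kappa> \<gamma> \<delta> lam \<mu> F G"
  assumes "\<And>i. maximal_comonotone (\<sigma> i) (A i)"
    and "maximal_comonotone \<sigma>m Am"
    and "zer (\<lambda>p. (\<Sum>i\<in>UNIV. A i p) + Am p) \<noteq> {}"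
    and "\<gamma> > 0" "\<delta> > 0" "lam > 0" "\<mu> > 0"
    and "(lam - 1) * (\<mu> - 1) = 1"
    and "\<delta> = \<gamma> * (lam - 1)"
    and "cond_C1 \<sigma> \<sigma>m \<gamma> \<delta> \<or> cond_C2 \<sigma> \<sigma>m \<gamma> \<delta> \<or> cond_C3 \<sigma> \<sigma>m \<gamma> \<delta> lam \<mu> \<kappa>"
    and "kappa_star \<sigma> \<sigma>m \<gamma> \<delta> lam \<mu> \<kappa> > 0"
    and "0 < \<kappa>" "\<kappa> < kappa_star \<sigma> \<sigma>m \<gamma> \<delta> lam \<mu> \<kappa>"
    and "\<And>k. y k \<in> resolvent \<gamma> F (x k)"
    and "\<And>k. z k \<in> resolvent \<delta> G ((1 - lam) *\<^sub>R x k + lam *\<^sub>R y k)"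
    and "\<And>k. x (Suc k) = x k + (\<kappa> * \<mu>) *\<^sub>R (z k - y k)"
  shows "\<exists>xbar p.
      (xbar \<in> Fix T \<and> resolvent \<gamma> F xbar = {p} \<and> p \<in> zer (\<lambda>v. F v + G v) \<and>
       weakly_tendsto x xbar) \<and>
      ((\<lambda>k. norm (x k - x (Suc k))) \<in> o(\<lambda>k. 1 / sqrt (real k)) \<and>
       (\<lambda>k. norm (y k - y (Suc k))) \<in> o(\<lambda>k. 1 / sqrt (real k))) \<and>
      (weakly_tendsto y p \<and> weakly_tendsto z p) \<and>
      ((cond_C2 \<sigma> \<sigma>m \<gamma> \<delta> \<and> \<sigma>m = 0) \<or> cond_C3 \<sigma> \<sigma>m \<gamma> \<delta> lam \<mu> \<kappa> \<longrightarrow>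
       (\<lambda>v. \<gamma> *\<^sub>R v) ` yosida \<gamma> F xbar = {xbar - p} \<and>
       (\<lambda>k. x k - y k) \<longlonglongrightarrow> xbar - p \<and>
       (\<lambda>k. x k - z k) \<longlonglongrightarrow> xbar - p \<and>
       (\<lambda>v. \<gamma> *\<^sub>R v) ` yosida \<gamma> F xbar + zer (\<lambda>v. F v + G v) = Fix T)"
proof -
  note F_def = assms(1) and G_def = assms(2) and T_def = assms(3)
  obtain \<theta> \<epsilon> \<eta> where par:
    "\<And>i. \<theta> i > 0" "(\<Sum>i\<in>UNIV. 1 / \<theta> i) = 1"
    "\<And>i. \<sigma> i \<ge> 0" "\<And>i. \<sigma> i + \<sigma>m * \<theta> i \<ge> 0" "\<sigma>m \<le> 0" "\<epsilon> > 0" "\<eta> \<ge> 0"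
    "\<And>i. \<And>a b :: 'a. (\<kappa> * (\<gamma> + \<delta>) / 2 + \<epsilon>) * (norm (a + b))\<^sup>2 + \<eta> * (norm a)\<^sup>2
      \<le> \<sigma> i * (norm a)\<^sup>2 + \<sigma>m * \<theta> i * (norm b)\<^sup>2 + \<gamma> * inner a (a + b) + \<delta> * inner b (a + b)"
    and \<eta>: "cond_C2 \<sigma> \<sigma>m \<gamma> \<delta> \<or> cond_C3 \<sigma> \<sigma>m \<gamma> \<delta> lam \<mu> \<kappa> \<Longrightarrow> \<eta> > 0"
    using parameter_margin[OF assms(7,8,13,16)] by metis
  interpret DR: DR_splitting A Am \<sigma> \<theta> \<sigma>m \<gamma> \<delta> \<kappa> \<epsilon> \<eta>
    using assms(4,5,7,8,15) par by unfold_locales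
  have Fix_T: "f \<in> Fix T \<longleftrightarrow> (\<exists>a. DR_step \<gamma> \<delta> F G f a (- a))" for f
    unfolding T_def by (rule Fix_adaptive_DR[OF assms(7,8,15,11,12)])
  have "\<forall>k. \<exists>a b. DR_step \<gamma> \<delta> F G (x k) a b \<and> y k = x k - \<gamma> *\<^sub>R a \<and> z k = y k - \<delta> *\<^sub>R (a + b)"
    using DR_step_of_resolvents[OF assms(12,17,18)] by metis
  then obtain a b where step: "\<And>k. DR_step \<gamma> \<delta> F G (x k) (a k) (b k)"
    and y: "\<And>k. y k = x k - \<gamma> *\<^sub>R a k" and z: "\<And>k. z k = y k - \<delta> *\<^sub>R (a k + b k)"
    by metis
  \<comment> \<open>As z_k - y_k = - \<delta> (a_k + b_k), the factor \<mu> \<delta> = \<gamma> +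
    \<delta> turns the update into subtraction of \<tau> (a_k + b_k).\<close>
  have "\<delta> * (\<mu> - 1) = \<gamma>" using assms(11,12) by (metis mult.assoc mult.right_neutral)
  then have \<mu>: "\<mu> * \<delta> = \<gamma> + \<delta>" by (simp add: algebra_simps)
  have x_Suc: "x (Suc k) = x k - (\<kappa> * (\<gamma> + \<delta>)) *\<^sub>R (a k + b k)" for k
    by (simp add: assms(19) z \<mu>[symmetric] mult.assoc)
  obtain f af where "DR_step \<gamma> \<delta> F G f af (- af)"
    unfolding F_def G_def by (rule DR.step_fixed_exists[OF assms(6)])
  then obtain xbar abar where bar: "DR_step \<gamma> \<delta> F G xbar abar (- abar)"
    and x_weak: "weakly_tendsto x xbar" and a_weak: "weakly_tendsto a abar"
    and ab: "(\<lambda>k. a k + b k) \<longlonglongrightarrow> 0"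
    and rate_x: "(\<lambda>k. norm (x k - x (Suc k))) \<in> o(\<lambda>k. 1 / sqrt (real k))"
    and rate_y: "(\<lambda>k. norm ((x k - \<gamma> *\<^sub>R a k) - (x (Suc k) - \<gamma> *\<^sub>R a (Suc k))))
      \<in> o(\<lambda>k. 1 / sqrt (real k))"
    and a_strong: "\<eta> > 0 \<Longrightarrow> a \<longlonglongrightarrow> abar"
    by (rule DR.convergence[of x a b f af, folded F_def G_def, OF step x_Suc]) (rule that; simp)
  define p where "p = xbar - \<gamma> *\<^sub>R abar"
  have res: "resolvent \<gamma> F xbar = {p}"
    unfolding p_def by (rule DR.resolvent_F_fixed[folded F_def G_def, OF bar])
  have yos: "(\<lambda>v. \<gamma> *\<^sub>R v) ` yosida \<gamma> F xbar = {xbar - p}"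
    using assms(7) by (simp add: yosida_def res)
  have zer: "q \<in> zer (\<lambda>v. F v + G v) \<longleftrightarrow> (\<exists>a. DR_step \<gamma> \<delta> F G (q + \<gamma> *\<^sub>R a) a (- a))" for q
    by (simp add: mem_zer_plus_iff DR_step_def)
  have y_weak: "weakly_tendsto y p"
    using weakly_tendsto_add[OF x_weak weakly_tendsto_scaleR[OF a_weak, of "- \<gamma>"]]
    by (simp add: p_def flip: y)
  have \<delta>ab: "(\<lambda>k. \<delta> *\<^sub>R (a k + b k)) \<longlonglongrightarrow> 0"
    using tendsto_scaleR[OF tendsto_const ab, of \<delta>] by simp
  have z_weak: "weakly_tendsto z p"
    using weakly_tendsto_add[OF y_weak weakly_tendsto_scaleR[OF tendsto_imp_weakly_tendsto[OF \<delta>ab], of "-1"]]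
    by (simp flip: z)
  have strong: "(\<lambda>k. x k - y k) \<longlonglongrightarrow> xbar - p \<and> (\<lambda>k. x k - z k) \<longlonglongrightarrow> xbar - p \<and>
      (\<lambda>v. \<gamma> *\<^sub>R v) ` yosida \<gamma> F xbar + zer (\<lambda>v. F v + G v) = Fix T" if "\<eta> > 0"
  proof (intro conjI)
    have xy: "(\<lambda>k. \<gamma> *\<^sub>R a k) \<longlonglongrightarrow> xbar - p"
      using tendsto_scaleR[OF tendsto_const a_strong[OF that], of \<gamma>] by (simp add: p_def)
    then show "(\<lambda>k. x k - y k) \<longlonglongrightarrow> xbar - p" by (simp add: y)
    show "(\<lambda>k. x k - z k) \<longlonglongrightarrow> xbar - p"
      using tendsto_add[OF \<delta>ab xy] by (simp add: z y)
    \<comment> \<open>All fixed points share the dual vector \<open>abar\<close>, so passing from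
      zeros of F + G to fixed points is translation by the single vector \<gamma>
      \<open>abar\<close>.\<close>
    have dual: "a' = abar" if "DR_step \<gamma> \<delta> F G f' a' (- a')" for f' a'
      by (rule DR.step_fixed_dual_unique[of f' a' xbar abar, folded F_def G_def, OF \<open>\<eta> > 0\<close> that bar])
    show "(\<lambda>v. \<gamma> *\<^sub>R v) ` yosida \<gamma> F xbar + zer (\<lambda>v. F v + G v) = Fix T"
    proof (rule set_eqI)
      fix f
      have "f \<in> (\<lambda>v. \<gamma> *\<^sub>R v) ` yosida \<gamma> F xbar + zer (\<lambda>v. F v + G v)
          \<longleftrightarrow> f - \<gamma> *\<^sub>R abar \<in> zer (\<lambda>v. F v + G v)"
        unfolding yos mem_singleton_plus_iff by (simp add: p_def)
      also have "\<dots> \<longleftrightarrow> DR_step \<gamma> \<delta> F G f abar (- abar)"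
      proof
        assume "f - \<gamma> *\<^sub>R abar \<in> zer (\<lambda>v. F v + G v)"
        then obtain a' where a': "DR_step \<gamma> \<delta> F G (f - \<gamma> *\<^sub>R abar + \<gamma> *\<^sub>R a') a' (- a')"
          unfolding zer by blast
        from a' show "DR_step \<gamma> \<delta> F G f abar (- abar)"
          unfolding dual[OF a'] by simp
      next
        assume "DR_step \<gamma> \<delta> F G f abar (- abar)"
        then show "f - \<gamma> *\<^sub>R abar \<in> zer (\<lambda>v. F v + G v)"
          unfolding zer by (intro exI[of _ abar]) simp
      qed
      also have "\<dots> \<longleftrightarrow> f \<in> Fix T"
        unfolding Fix_T by (metis dual)
      finally show "f \<in> (\<lambda>v. \<gamma> *\<^sub>R v) ` yosida \<gamma> F xbar + zer (\<lambda>v. F v + G v) \<longleftrightarrow> f \<in> Fix T" .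
    qed
  qed
  have p_zer: "p \<in> zer (\<lambda>v. F v + G v)"
    unfolding zer using bar by (intro exI[of _ abar]) (simp add: p_def)
  have xbar_Fix: "xbar \<in> Fix T" unfolding Fix_T using bar by blast
  have rate_y': "(\<lambda>k. norm (y k - y (Suc k))) \<in> o(\<lambda>k. 1 / sqrt (real k))"
    unfolding y by (rule rate_y)
  have strong': "(cond_C2 \<sigma> \<sigma>m \<gamma> \<delta> \<and> \<sigma>m = 0) \<or> cond_C3 \<sigma> \<sigma>m \<gamma> \<delta> lam \<mu> \<kappa> \<longrightarrow>
      (\<lambda>v. \<gamma> *\<^sub>R v) ` yosida \<gamma> F xbar = {xbar - p} \<and>
      (\<lambda>k. x k - y k) \<longlonglongrightarrow> xbar - p \<and>
      (\<lambda>k. x k - z k) \<longlonglongrightarrow> xbar - p \<and>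
      (\<lambda>v. \<gamma> *\<^sub>R v) ` yosida \<gamma> F xbar + zer (\<lambda>v. F v + G v) = Fix T"
    by (rule impI, rule conjI[OF yos strong[OF \<eta>]]) blast
  show ?thesis
    by (rule exI[of _ xbar], rule exI[of _ p], intro conjI)
      (fact xbar_Fix res p_zer x_weak rate_x rate_y' y_weak z_weak strong')+
qed

end
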